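(* There is a number $N$ such that any element of the Grigorchuk group $\Gamma$ belonging to the verbal subgroup generated by squares (i.e. the subgroup generated by $\{g^2 : g\in\Gamma\}$) is a product of at most $N$ squares of elements of $\Gamma$.
   Context: The Grigorchuk group. Let $\mathcal{T}$ be the infinite rooted regular binary tree with vertex set $\{0,1\}^*$ (finite binary words, root the empty word). $\Gamma\le \mathrm{Aut}(\mathcal{T})$ is the group generated by the automorphisms $a,b,c,d$ defined (recursively) for all $w\in\{0,1\}^*$ by $a(0w)=1w$, $a(1w)=0w$; $b(0w)=0a(w)$, $b(1w)=1c(w)$; $c(0w)=0a(w)$, $c(1w)=1d(w)$; $d(0w)=0w$, $d(1w)=1b(w)$ (each fixes the root). *)

theory Defs
  imports "HOL-Algebra.Algebra"
begin

text \<open>Vertices of the rooted binary tree are finite words over \<open>{0,1}\<close>; the letter 0 is encoded as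
  \<^const>\<open>False\<close> and 1 as \<^const>\<open>True\<close>.\<close>

type_synonym vertex = "bool list"

definition tree_adj :: "vertex \<Rightarrow> vertex \<Rightarrow> bool" where
  "tree_adj u v \<longleftrightarrow> (\<exists>x. v = u @ [x]) \<or> (\<exists>x. u = v @ [x])"

definition tree_auts :: "(vertex \<Rightarrow> vertex) set" where
  "tree_auts = {f. bij f \<and> f [] = [] \<and> (\<forall>u v. tree_adj (f u) (f v) \<longleftrightarrow> tree_adj u v)}"

definition Aut_tree :: "(vertex \<Rightarrow> vertex) monoid" where
  "Aut_tree = BijGroup UNIV \<lparr>carrier := tree_auts\<rparr>"

fun grig_a :: "vertex \<Rightarrow> vertex" where
  "grig_a [] = []"
| "grig_a (False # w) = True # w"
| "grig_a (True # w) = False # w"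

fun grig_b :: "vertex \<Rightarrow> vertex"
  and grig_c :: "vertex \<Rightarrow> vertex"
  and grig_d :: "vertex \<Rightarrow> vertex" where
  "grig_b [] = []"
| "grig_b (False # w) = False # grig_a w"
| "grig_b (True # w) = True # grig_c w"
| "grig_c [] = []"
| "grig_c (False # w) = False # grig_a w"
| "grig_c (True # w) = True # grig_d w"
| "grig_d [] = []"
| "grig_d (False # w) = False # w"
| "grig_d (True # w) = True # grig_b w"

text \<open>\<^const>\<open>subgroup_generated\<close> intersects the generating set with the carrier;
  \<open>grig_generators_in_Aut_tree\<close> below shows that no generator is lost.\<close>

definition Grigorchuk_group :: "(vertex \<Rightarrow> vertex) monoid" where
  "Grigorchuk_group = subgroup_generated Aut_tree {grig_a, grig_b, grig_c, grig_d}"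

definition squares :: "('a, 'b) monoid_scheme \<Rightarrow> 'a set" where
  "squares G = {g [^]\<^bsub>G\<^esub> (2::nat) | g. g \<in> carrier G}"

definition list_product :: "('a, 'b) monoid_scheme \<Rightarrow> 'a list \<Rightarrow> 'a" where
  "list_product G xs = foldr (\<otimes>\<^bsub>G\<^esub>) xs \<one>\<^bsub>G\<^esub>"

lemma subgroup_tree_auts: "subgroup tree_auts (BijGroup UNIV)"
proof -
  have bij: "carrier (BijGroup UNIV) = {f :: vertex \<Rightarrow> vertex. bij f}"
    by (auto simp: BijGroup_def Bij_def)
  show ?thesis
  proof (rule group.subgroupI[OF group_BijGroup])
    show "tree_auts \<subseteq> carrier (BijGroup UNIV)"
      by (auto simp: bij tree_auts_def)
    have "id \<in> tree_auts" by (simp add: tree_auts_def)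
    then show "tree_auts \<noteq> {}" by blast
  next
    fix f assume f: "f \<in> tree_auts"
    then have b: "bij f" and r: "f [] = []"
      and adj: "\<And>u v. tree_adj (f u) (f v) \<longleftrightarrow> tree_adj u v"
      by (auto simp: tree_auts_def)
    have i: "inv\<^bsub>BijGroup UNIV\<^esub> f = inv_into UNIV f"
      using b by (subst inv_BijGroup) (auto simp: Bij_def restrict_def)
    have "inv_into UNIV f [] = []"
      using b r by (metis bij_inv_eq_iff)
    moreover have "tree_adj (inv_into UNIV f u) (inv_into UNIV f v) \<longleftrightarrow> tree_adj u v" for u v
      using adj[of "inv_into UNIV f u" "inv_into UNIV f v"]
      by (simp only: surj_f_inv_f[OF bij_is_surj[OF b]])
    ultimately show "inv\<^bsub>BijGroup UNIV\<^esub> f \<in> tree_auts"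
      unfolding i tree_auts_def using bij_imp_bij_inv[OF b] by blast
  next
    fix f g assume fg: "f \<in> tree_auts" "g \<in> tree_auts"
    then have "f \<otimes>\<^bsub>BijGroup UNIV\<^esub> g = f \<circ> g"
      by (auto simp: tree_auts_def BijGroup_def Bij_def compose_def)
    with fg show "f \<otimes>\<^bsub>BijGroup UNIV\<^esub> g \<in> tree_auts"
      by (auto simp: tree_auts_def bij_comp)
  qed
qed

lemma group_Aut_tree: "group Aut_tree"
  unfolding Aut_tree_def
  by (rule subgroup.subgroup_is_group[OF subgroup_tree_auts group_BijGroup])

lemma group_Grigorchuk_group: "group Grigorchuk_group"
  unfolding Grigorchuk_group_def by (rule group.group_subgroup_generated[OF group_Aut_tree])

lemma mult_Grigorchuk_group:
  assumes "f \<in> carrier Grigorchuk_group" "g \<in> carrier Grigorchuk_group"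
  shows "f \<otimes>\<^bsub>Grigorchuk_group\<^esub> g = f \<circ> g"
proof -
  have "carrier Grigorchuk_group \<subseteq> carrier Aut_tree"
    unfolding Grigorchuk_group_def
    by (rule group.carrier_subgroup_generated_subset[OF group_Aut_tree])
  with assms have "f \<in> tree_auts" "g \<in> tree_auts"
    by (auto simp: Aut_tree_def)
  then show ?thesis
    by (auto simp: Grigorchuk_group_def Aut_tree_def tree_auts_def BijGroup_def Bij_def compose_def)
qed

lemma one_Grigorchuk_group: "\<one>\<^bsub>Grigorchuk_group\<^esub> = id"
  by (auto simp: Grigorchuk_group_def Aut_tree_def BijGroup_def)

lemma tree_auts_involutionI:
  assumes inv: "\<And>w. f (f w) = w" and root: "f [] = []"
    and child: "\<And>u x. \<exists>y. f (u @ [x]) = f u @ [y]"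
  shows "f \<in> tree_auts"
proof -
  have "bij f" using inv by (intro o_bij[of f f]) auto
  moreover have fwd: "tree_adj (f u) (f v)" if uv: "tree_adj u v" for u v
  proof -
    consider x where "v = u @ [x]" | x where "u = v @ [x]"
      using uv unfolding tree_adj_def by blast
    then show ?thesis
    proof cases
      case 1
      then show ?thesis using child[of u x] unfolding tree_adj_def by blast
    next
      case 2
      then show ?thesis using child[of v x] unfolding tree_adj_def by blast
    qed
  qed
  moreover have "tree_adj u v" if "tree_adj (f u) (f v)" for u v
    using fwd[OF that] by (simp only: inv)
  ultimately show ?thesis unfolding tree_auts_def using root by blast
qed

lemma grig_a_involution: "grig_a (grig_a w) = w"
  by (cases w rule: grig_a.cases) auto

lemma grig_a_child: "\<exists>y. grig_a (u @ [x]) = grig_a u @ [y]"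
  by (cases u rule: grig_a.cases; cases x) auto

lemma grig_bcd_involution:
  "grig_b (grig_b w) = w" "grig_c (grig_c w) = w" "grig_d (grig_d w) = w"
  by (induction w and w and w rule: grig_b_grig_c_grig_d.induct)
    (simp_all add: grig_a_involution)

lemma grig_bcd_singleton: "grig_b [x] = [x]" "grig_c [x] = [x]" "grig_d [x] = [x]"
  by (cases x; simp)+

lemma grig_bcd_child:
  "\<exists>y. grig_b (u @ [x]) = grig_b u @ [y]"
  "\<exists>y. grig_c (u @ [x]) = grig_c u @ [y]"
  "\<exists>y. grig_d (u @ [x]) = grig_d u @ [y]"
  by (induction u and u and u rule: grig_b_grig_c_grig_d.induct)
    (simp_all add: grig_a_child grig_bcd_singleton)

lemma grig_generators_in_Aut_tree:
  "{grig_a, grig_b, grig_c, grig_d} \<subseteq> carrier Aut_tree"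
proof -
  have "grig_a \<in> tree_auts"
    by (rule tree_auts_involutionI[OF grig_a_involution grig_a.simps(1) grig_a_child])
  moreover have "grig_b \<in> tree_auts"
    by (rule tree_auts_involutionI[OF grig_bcd_involution(1) grig_b.simps(1) grig_bcd_child(1)])
  moreover have "grig_c \<in> tree_auts"
    by (rule tree_auts_involutionI[OF grig_bcd_involution(2) grig_c.simps(1) grig_bcd_child(2)])
  moreover have "grig_d \<in> tree_auts"
    by (rule tree_auts_involutionI[OF grig_bcd_involution(3) grig_d.simps(1) grig_bcd_child(3)])
  ultimately show ?thesis by (simp add: Aut_tree_def)
qed

lemma carrier_Grigorchuk_group:
  "carrier Grigorchuk_group = generate Aut_tree {grig_a, grig_b, grig_c, grig_d}"
  using grig_generators_in_Aut_tree
  by (simp add: Grigorchuk_group_def carrier_subgroup_generated Int_absorb1)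

end

theory Submission
  imports Defs
begin

text \<open>Write \<open>node f g\<close> for the tree automorphism acting as \<open>f\<close> below 0 and as \<open>g\<close> below 1, and let
  \<open>K\<close> be the normal closure of \<open>\<tau> = (ab)\<^sup>2\<close>. The subgroup \<open>K\<close> has finite index, and the group is
  regular branch over it: \<open>node k l \<in> K\<close> whenever \<open>k, l \<in> K\<close> (\<open>node_in_K\<close>). The proof bounds the
  width with respect to squares of elements of \<open>K\<close> only. These have the advantage that products of
  \<open>n\<close> of them can be placed side by side at no cost: if \<open>x\<close> and \<open>y\<close> are products of \<open>n\<close> such
  squares, then so is \<open>node x y\<close> (\<open>node_in_\<Sigma>\<close>).

  Let \<open>K2\<close> be the subgroup generated by the squares of elements of \<open>K\<close>. It has finite index,
  because \<open>K / K2\<close> is an elementary abelian 2-group, and conjugation by \<open>K\<close> is trivial on it, so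
  that finitely many conjugates of \<open>\<tau>\<close> generate it. Hence an element of \<open>K2\<close> is, up to one of
  finitely many factors in \<open>K2\<close>, of the form \<open>node (node h00 h01) (node h10 h11)\<close> with all four
  entries in \<open>K2\<close> (\<open>K2_second_level\<close>).

  The decisive point is a merging trick. The element \<open>\<tau>\<close> interchanges the vertices 00 and 01, and
  10 and 11, and in every group \<open>(\<tau>\<inverse> D \<tau>) D = (\<tau>\<inverse>)\<^sup>2 (\<tau> D)\<^sup>2\<close>. So two squares suffice to
  multiply the entry at 00 by an arbitrary \<open>p \<in> K\<close>, provided the entry at 01 is multiplied by a
  conjugate of \<open>p\<close>, and likewise at 10 and 11. Only the merged elements
  \<open>(a h00\<inverse> a) h01\<close> and \<open>(d h10\<inverse> d) h11\<close> matter therefore; and if each of these is a product of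
  \<open>2n\<close> squares, then distributing \<open>n\<close> of them to each of the two vertices gives the whole element
  with \<open>n + 2\<close> squares (\<open>merge_in_\<Sigma>\<close>).

  Passing to the entries at the second level divides word length by four, up to a constant, and so
  the merged elements have about half the length of the original one. Induction on length shows
  that \<open>2n\<close> squares always suffice, once \<open>n\<close> is large enough to absorb the constants and to cover
  the finitely many short elements (\<open>K2_bounded_width\<close>). The verbal subgroup generated by all
  squares meets only finitely many cosets of \<open>K2\<close>, and one representative of each costs a bounded
  number of further squares.\<close>

section \<open>Finite subsets and representatives\<close>

lemma finite_subset_chain:
  fixes B :: "nat \<Rightarrow> 'a set"
  assumes "finite A" and "\<And>x. x \<in> A \<Longrightarrow> \<exists>n. x \<in> B n" and mono: "\<And>m n. m \<le> n \<Longrightarrow> B m \<subseteq> B n"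
  shows "\<exists>n. A \<subseteq> B n"
  using assms(1,2)
proof (induction A rule: finite_induct)
  case (insert x A)
  obtain m where m: "x \<in> B m" using insert.prems by blast
  obtain n where n: "A \<subseteq> B n" using insert.IH insert.prems by blast
  have "insert x A \<subseteq> B (max m n)"
    using m n mono[of m "max m n"] mono[of n "max m n"] by auto
  then show ?case by blast
qed simp

text \<open>Choosing one element of \<open>Q\<close> for every label that occurs replaces the labels, which need not lie in
  \<open>Q\<close>, by finitely many representatives from \<open>Q\<close>. It is applied with cosets as labels.\<close>

lemma finite_representatives:
  assumes "finite A" "\<And>x. x \<in> Q \<Longrightarrow> \<exists>s\<in>A. P x s"
  obtains T where "finite T" "T \<subseteq> Q" "\<And>x. x \<in> Q \<Longrightarrow> \<exists>t\<in>T. \<exists>s\<in>A. P t s \<and> P x s"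
proof
  define rep where "rep s = (SOME x. x \<in> Q \<and> P x s)" for s
  define T where "T = rep ` {s \<in> A. \<exists>x\<in>Q. P x s}"
  have rep: "rep s \<in> Q \<and> P (rep s) s" if "x \<in> Q" "P x s" for x s
    unfolding rep_def by (rule someI[of "\<lambda>x. x \<in> Q \<and> P x s" x]) (use that in simp)
  show "finite T" using assms(1) by (simp add: T_def)
  show "T \<subseteq> Q" using rep by (auto simp: T_def)
  show "\<exists>t\<in>T. \<exists>s\<in>A. P t s \<and> P x s" if x: "x \<in> Q" for x
  proof -
    obtain s where s: "s \<in> A" "P x s" using assms(2)[OF x] by blast
    then have "rep s \<in> T" using x by (auto simp: T_def)
    then show ?thesis using rep[OF x s(2)] s by blast
  qed
qed

section \<open>Products of squares from a normal subgroup\<close>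

lemma set_multI: "\<lbrakk>e \<in> A; q \<in> B; x = e \<otimes>\<^bsub>G\<^esub> q\<rbrakk> \<Longrightarrow> x \<in> A <#>\<^bsub>G\<^esub> B"
  by (auto simp: set_mult_def)

lemma set_multE:
  assumes "x \<in> A <#>\<^bsub>G\<^esub> B"
  obtains e q where "e \<in> A" "q \<in> B" "x = e \<otimes>\<^bsub>G\<^esub> q"
  using assms by (auto simp: set_mult_def)

context group
begin

lemma cancel_left: "x \<in> carrier G \<Longrightarrow> y \<in> carrier G \<Longrightarrow> inv x \<otimes> (x \<otimes> y) = y"
  "x \<in> carrier G \<Longrightarrow> y \<in> carrier G \<Longrightarrow> x \<otimes> (inv x \<otimes> y) = y"
  by (simp_all add: m_assoc[symmetric])

lemmas group_word_simps = m_assoc inv_mult_group cancel_left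

end

primrec square_products :: "('a, 'b) monoid_scheme \<Rightarrow> 'a set \<Rightarrow> nat \<Rightarrow> 'a set" where
  "square_products G A 0 = {\<one>\<^bsub>G\<^esub>}"
| "square_products G A (Suc n) = {k \<otimes>\<^bsub>G\<^esub> k \<otimes>\<^bsub>G\<^esub> x | k x. k \<in> A \<and> x \<in> square_products G A n}"

context normal
begin

abbreviation SP where "SP \<equiv> square_products G H"

lemma square_products_subset: "SP n \<subseteq> H"
  by (induction n) auto

lemma square_products_carrier: "x \<in> SP n \<Longrightarrow> x \<in> carrier G"
  using square_products_subset subset by blast

lemma square_in_square_products: "k \<in> H \<Longrightarrow> k \<otimes> k \<in> SP (Suc 0)"
  by force

lemma square_products_mult:
  "x \<in> SP m \<Longrightarrow> y \<in> SP n \<Longrightarrow> x \<otimes> y \<in> SP (m + n)"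
proof (induction m arbitrary: x)
  case 0
  then show ?case using square_products_carrier[of y] by simp
next
  case (Suc m)
  then obtain k z where "k \<in> H" "z \<in> SP m" "x = k \<otimes> k \<otimes> z" by auto
  moreover from this have "x \<otimes> y = k \<otimes> k \<otimes> (z \<otimes> y)"
    using Suc.prems square_products_carrier by (simp add: m_assoc)
  ultimately show ?case using Suc.IH[of z] Suc.prems by auto
qed

lemma square_products_split:
  "x \<in> SP (m + n) \<Longrightarrow> \<exists>y\<in>SP m. \<exists>z\<in>SP n. x = y \<otimes> z"
proof (induction m arbitrary: x)
  case 0
  then show ?case using square_products_carrier by simp
next
  case (Suc m)
  then obtain k u where k: "k \<in> H" "u \<in> SP (m + n)" "x = k \<otimes> k \<otimes> u" by auto
  obtain y z where "y \<in> SP m" "z \<in> SP n" "u = y \<otimes> z" using Suc.IH[OF k(2)] by blast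
  moreover from this have "x = (k \<otimes> k \<otimes> y) \<otimes> z"
    using k square_products_carrier by (simp add: m_assoc)
  ultimately show ?case using k(1) by auto
qed

lemma square_products_mono: "m \<le> n \<Longrightarrow> SP m \<subseteq> SP n"
proof (induction rule: dec_induct)
  case (step n)
  have "x \<in> SP (Suc n)" if "x \<in> SP n" for x
    using square_products_mult[OF square_in_square_products[OF subgroup.one_closed[OF is_subgroup]] that]
      square_products_carrier[OF that] by simp
  with step show ?case by blast
qed simp

lemma square_products_conj:
  "g \<in> carrier G \<Longrightarrow> x \<in> SP n \<Longrightarrow> g \<otimes> x \<otimes> inv g \<in> SP n"
proof (induction n arbitrary: x)
  case (Suc n)
  then obtain k y where k: "k \<in> H" "y \<in> SP n" "x = k \<otimes> k \<otimes> y" by auto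
  let ?k = "g \<otimes> k \<otimes> inv g"
  have "g \<otimes> x \<otimes> inv g = ?k \<otimes> ?k \<otimes> (g \<otimes> y \<otimes> inv g)"
    using k Suc.prems square_products_carrier by (simp add: group_word_simps)
  moreover have "?k \<in> H" using k Suc.prems by (simp add: inv_op_closed2)
  ultimately show ?case using Suc.IH[OF Suc.prems(1) k(2)] by auto
qed simp

lemma square_products_inv: "x \<in> SP n \<Longrightarrow> inv x \<in> SP n"
proof (induction n arbitrary: x)
  case (Suc n)
  then obtain k y where k: "k \<in> H" "y \<in> SP n" "x = k \<otimes> k \<otimes> y" by auto
  have "inv x = inv y \<otimes> (inv k \<otimes> inv k)"
    using k square_products_carrier by (simp add: group_word_simps)
  moreover have "inv y \<otimes> (inv k \<otimes> inv k) \<in> SP (n + Suc 0)"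
    using k Suc.IH by (intro square_products_mult square_in_square_products) auto
  ultimately show ?case by simp
qed simp

definition square_subgroup where "square_subgroup = (\<Union>n. SP n)"

lemma square_subgroup_carrier: "x \<in> square_subgroup \<Longrightarrow> x \<in> carrier G"
  unfolding square_subgroup_def using square_products_carrier by blast

lemma square_in_square_subgroup: "k \<in> H \<Longrightarrow> k \<otimes> k \<in> square_subgroup"
  unfolding square_subgroup_def using square_in_square_products by blast

lemma square_subgroup_one: "\<one> \<in> square_subgroup"
  unfolding square_subgroup_def by (rule UN_I[of 0]) simp_all

lemma square_subgroup_mult:
  "x \<in> square_subgroup \<Longrightarrow> y \<in> square_subgroup \<Longrightarrow> x \<otimes> y \<in> square_subgroup"
  unfolding square_subgroup_def using square_products_mult by blast

lemma square_subgroup_inv: "x \<in> square_subgroup \<Longrightarrow> inv x \<in> square_subgroup"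
  unfolding square_subgroup_def using square_products_inv by blast

lemma square_subgroup_conj:
  "g \<in> carrier G \<Longrightarrow> x \<in> square_subgroup \<Longrightarrow> g \<otimes> x \<otimes> inv g \<in> square_subgroup"
  unfolding square_subgroup_def using square_products_conj by blast

lemma square_subgroup_conj':
  "g \<in> carrier G \<Longrightarrow> x \<in> square_subgroup \<Longrightarrow> inv g \<otimes> x \<otimes> g \<in> square_subgroup"
  using square_subgroup_conj[of "inv g" x] by simp

text \<open>\<open>x\<inverse> y\<inverse> x y = (x\<inverse>)\<^sup>2 (x y\<inverse>)\<^sup>2 y\<^sup>2\<close>: a quotient in which all squares vanish is abelian.\<close>

lemma commutator_in_square_subgroup:
  assumes "x \<in> H" "y \<in> H"
  shows "inv x \<otimes> inv y \<otimes> x \<otimes> y \<in> square_subgroup"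
proof -
  have "inv x \<otimes> inv y \<otimes> x \<otimes> y
      = (inv x \<otimes> inv x) \<otimes> ((x \<otimes> inv y) \<otimes> (x \<otimes> inv y)) \<otimes> (y \<otimes> y)"
    using assms by (simp add: group_word_simps)
  also have "\<dots> \<in> square_subgroup"
    using assms by (intro square_subgroup_mult square_in_square_subgroup) auto
  finally show ?thesis .
qed

text \<open>Modulo squares the elements of \<open>C\<close> are commuting involutions, so the products over subsets of \<open>C\<close>
  are closed under multiplication by \<open>C\<close>. The induction builds these products one generator at a
  time, which avoids passing to the quotient group.\<close>

lemma finite_span_mod_squares:
  assumes "finite C" "C \<subseteq> H"
  shows "\<exists>E. finite E \<and> E \<subseteq> H \<and> \<one> \<in> E \<and> (\<forall>c\<in>C. \<forall>e\<in>E. c \<otimes> e \<in> E <#> square_subgroup)"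
  using assms
proof (induction C rule: finite_induct)
  case empty
  have "\<one> \<in> H" by (rule subgroup.one_closed[OF is_subgroup])
  then show ?case by (intro exI[of _ "{\<one>}"]) simp
next
  case (insert c C)
  then have "C \<subseteq> H" and c: "c \<in> H" by simp_all
  from insert.IH[OF \<open>C \<subseteq> H\<close>] obtain E where E: "finite E" "E \<subseteq> H" "\<one> \<in> E"
    and step: "\<forall>c\<in>C. \<forall>e\<in>E. c \<otimes> e \<in> E <#> square_subgroup"
    by (elim exE conjE)
  define E' where "E' = E \<union> (\<lambda>e. c \<otimes> e) ` E"
  have E'I: "e \<in> E'" "c \<otimes> e \<in> E'" if "e \<in> E" for e using that by (simp_all add: E'_def)
  have E_car: "e \<in> carrier G" if "e \<in> E" for e using that E(2) subset by blast
  have c_car: "c \<in> carrier G" using c by simp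
  have "x \<otimes> e \<in> E' <#> square_subgroup" if x: "x \<in> insert c C" and e: "e \<in> E'" for x e
  proof -
    have xH: "x \<in> H" using x c \<open>C \<subseteq> H\<close> by blast
    then have x_car: "x \<in> carrier G" by simp
    consider "x = c" "e \<in> E" | e0 where "x = c" "e0 \<in> E" "e = c \<otimes> e0"
      | "x \<in> C" "e \<in> E" | e0 where "x \<in> C" "e0 \<in> E" "e = c \<otimes> e0"
      using x e unfolding E'_def by blast
    then show ?thesis
    proof cases
      case 1
      then have "x \<otimes> e = (c \<otimes> e) \<otimes> \<one>" using E_car c_car by simp
      with E'I(2)[OF 1(2)] square_subgroup_one show ?thesis by (rule set_multI)
    next
      case 2
      have "x \<otimes> e = e0 \<otimes> (inv e0 \<otimes> (c \<otimes> c) \<otimes> e0)"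
        using 2(1,3) E_car[OF 2(2)] c_car by (simp add: group_word_simps)
      moreover have "inv e0 \<otimes> (c \<otimes> c) \<otimes> e0 \<in> square_subgroup"
        by (intro square_subgroup_conj' square_in_square_subgroup c E_car 2(2))
      ultimately show ?thesis using E'I(1)[OF 2(2)] by (intro set_multI)
    next
      case 3
      then have "x \<otimes> e \<in> E <#> square_subgroup" using step by blast
      then show ?thesis by (elim set_multE) (intro set_multI E'I)
    next
      case 4
      then have "x \<otimes> e0 \<in> E <#> square_subgroup" using step by blast
      then obtain e1 q where e1: "e1 \<in> E" "q \<in> square_subgroup" "x \<otimes> e0 = e1 \<otimes> q"
        by (elim set_multE)
      let ?k = "inv x \<otimes> inv c \<otimes> x \<otimes> c"
      note car = x_car c_car E_car[OF 4(2)] E_car[OF e1(1)] square_subgroup_carrier[OF e1(2)]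
      have "x \<otimes> e = c \<otimes> (x \<otimes> e0) \<otimes> (inv e0 \<otimes> ?k \<otimes> e0)"
        using car 4(3) by (simp add: group_word_simps)
      also have "\<dots> = (c \<otimes> e1) \<otimes> (q \<otimes> (inv e0 \<otimes> ?k \<otimes> e0))"
        unfolding e1(3) using car by (simp add: group_word_simps)
      finally have "x \<otimes> e = (c \<otimes> e1) \<otimes> (q \<otimes> (inv e0 \<otimes> ?k \<otimes> e0))" .
      moreover have "q \<otimes> (inv e0 \<otimes> ?k \<otimes> e0) \<in> square_subgroup"
        by (intro square_subgroup_mult square_subgroup_conj' commutator_in_square_subgroup
            e1(2) xH c car)
      ultimately show ?thesis using E'I(2)[OF e1(1)] by (intro set_multI)
    qed
  qed
  then have "\<forall>x\<in>insert c C. \<forall>e\<in>E'. x \<otimes> e \<in> E' <#> square_subgroup" by blast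
  moreover have "finite E'" using E(1) by (simp add: E'_def)
  moreover have "E' \<subseteq> H"
    using E(2) c subgroup.m_closed[OF is_subgroup] unfolding E'_def by blast
  moreover have "\<one> \<in> E'" using E(3) by (rule E'I)
  ultimately show ?case by (intro exI[of _ E'] conjI)
qed

text \<open>Since \<open>H\<close> modulo its squares is abelian, a conjugate of \<open>t\<close> by \<open>r k\<close> with \<open>k \<in> H\<close> agrees with the
  conjugate by \<open>r\<close>. Finitely many of the generating conjugates are therefore left, and
  \<open>finite_span_mod_squares\<close> applies to them.\<close>

lemma square_subgroup_finite_index:
  assumes R: "finite R" "R \<subseteq> carrier G"
    and cover: "carrier G \<subseteq> R <#> H"
    and T: "finite T" "T \<subseteq> H"
    and gen: "H \<subseteq> generate G {g \<otimes> t \<otimes> inv g | g t. g \<in> carrier G \<and> t \<in> T}"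
  shows "\<exists>S. finite S \<and> S \<subseteq> carrier G \<and> carrier G \<subseteq> S <#> square_subgroup"
proof -
  define C where "C = (\<lambda>(r, t). r \<otimes> t \<otimes> inv r) ` (R \<times> T)"
  have "finite C" using R T by (simp add: C_def)
  have CH: "C \<subseteq> H"
  proof
    fix c assume "c \<in> C"
    then obtain r t where "r \<in> R" "t \<in> T" "c = r \<otimes> t \<otimes> inv r" by (auto simp: C_def)
    then show "c \<in> H" using R T inv_op_closed2[of r t] by blast
  qed
  from finite_span_mod_squares[OF \<open>finite C\<close> CH]
  obtain E where E: "finite E" "E \<subseteq> H" "\<one> \<in> E"
    and step: "\<forall>c\<in>C. \<forall>e\<in>E. c \<otimes> e \<in> E <#> square_subgroup"
    by (elim exE conjE)
  have E_car: "e \<in> carrier G" if "e \<in> E" for e using that E(2) subset by blast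
  have C_car: "c \<in> carrier G" if "c \<in> C" for c using that CH subset by blast
  have step_mod: "c \<otimes> q0 \<otimes> e \<in> E <#> square_subgroup"
    if "c \<in> C" "q0 \<in> square_subgroup" "e \<in> E" for c q0 e
  proof -
    have "c \<otimes> e \<in> E <#> square_subgroup" using step that by blast
    then obtain e1 q where e1: "e1 \<in> E" "q \<in> square_subgroup" "c \<otimes> e = e1 \<otimes> q"
      by (elim set_multE)
    note car = C_car[OF that(1)] square_subgroup_carrier[OF that(2)] E_car[OF that(3)]
      E_car[OF e1(1)] square_subgroup_carrier[OF e1(2)]
    have "c \<otimes> q0 \<otimes> e = (c \<otimes> e) \<otimes> (inv e \<otimes> q0 \<otimes> e)"
      using car by (simp add: group_word_simps)
    also have "\<dots> = e1 \<otimes> (q \<otimes> (inv e \<otimes> q0 \<otimes> e))"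
      unfolding e1(3) using car by (simp add: group_word_simps)
    finally have "c \<otimes> q0 \<otimes> e = e1 \<otimes> (q \<otimes> (inv e \<otimes> q0 \<otimes> e))" .
    moreover have "q \<otimes> (inv e \<otimes> q0 \<otimes> e) \<in> square_subgroup"
      by (intro square_subgroup_mult square_subgroup_conj' car e1(2) that(2))
    ultimately show ?thesis using e1(1) by (intro set_multI)
  qed
  have conj_form: "g \<otimes> t \<otimes> inv g \<in> C <#> square_subgroup"
    if g: "g \<in> carrier G" and t: "t \<in> T" for g t
  proof -
    obtain r k where r: "r \<in> R" "k \<in> H" "g = r \<otimes> k" using g cover by (blast elim: set_multE)
    have tH: "t \<in> H" using t T by blast
    have car: "r \<in> carrier G" "k \<in> carrier G" "t \<in> carrier G" using r(1,2) R(2) tH by auto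
    let ?q = "inv t \<otimes> inv (inv k) \<otimes> t \<otimes> inv k"
    have "g \<otimes> t \<otimes> inv g = (r \<otimes> t \<otimes> inv r) \<otimes> (r \<otimes> ?q \<otimes> inv r)"
      using car r(3) by (simp add: group_word_simps)
    moreover have "r \<otimes> ?q \<otimes> inv r \<in> square_subgroup"
      using r(2) by (intro square_subgroup_conj commutator_in_square_subgroup car tH) simp
    moreover have "r \<otimes> t \<otimes> inv r \<in> C" using r(1) t by (auto simp: C_def)
    ultimately show ?thesis by (intro set_multI)
  qed
  let ?gens = "{g \<otimes> t \<otimes> inv g | g t. g \<in> carrier G \<and> t \<in> T}"
  have gens_car: "?gens \<subseteq> carrier G" using T(2) subset by auto
  have span: "\<forall>e\<in>E. x \<otimes> e \<in> E <#> square_subgroup" if "x \<in> generate G ?gens" for x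
    using that
  proof (induction rule: generate.induct)
    case one
    show ?case
    proof
      fix e assume e: "e \<in> E"
      then have "\<one> \<otimes> e = e \<otimes> \<one>" using E_car by simp
      with e square_subgroup_one show "\<one> \<otimes> e \<in> E <#> square_subgroup" by (rule set_multI)
    qed
  next
    case (incl h)
    then have "h \<in> C <#> square_subgroup" using conj_form by blast
    then show ?case using step_mod by (auto elim!: set_multE)
  next
    case (inv h)
    then have "h \<in> C <#> square_subgroup" using conj_form by blast
    then obtain c q where c: "c \<in> C" "q \<in> square_subgroup" "h = c \<otimes> q" by (elim set_multE)
    let ?q = "(inv c \<otimes> inv q \<otimes> c) \<otimes> (inv c \<otimes> inv c)"
    have "inv h = c \<otimes> ?q"
      using c(3) C_car[OF c(1)] square_subgroup_carrier[OF c(2)] by (simp add: group_word_simps)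
    moreover have "inv c \<in> H" using c(1) CH by blast
    then have "?q \<in> square_subgroup"
      by (intro square_subgroup_mult square_subgroup_conj' square_subgroup_inv
          square_in_square_subgroup C_car c(1,2))
    ultimately show ?case using step_mod[OF c(1), of ?q] by simp
  next
    case (eng h1 h2)
    have h: "h1 \<in> carrier G" "h2 \<in> carrier G"
      using eng.hyps generate_incl[OF gens_car] by blast+
    show ?case
    proof
      fix e assume e: "e \<in> E"
      have "h2 \<otimes> e \<in> E <#> square_subgroup" using eng.IH(2) e by blast
      then obtain e1 q1 where 1: "e1 \<in> E" "q1 \<in> square_subgroup" "h2 \<otimes> e = e1 \<otimes> q1"
        by (elim set_multE)
      have "h1 \<otimes> e1 \<in> E <#> square_subgroup" using eng.IH(1) 1(1) by blast
      then obtain e2 q2 where 2: "e2 \<in> E" "q2 \<in> square_subgroup" "h1 \<otimes> e1 = e2 \<otimes> q2"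
        by (elim set_multE)
      note car = square_subgroup_carrier[OF 1(2)] square_subgroup_carrier[OF 2(2)]
        E_car[OF e] E_car[OF 1(1)] E_car[OF 2(1)]
      have "h1 \<otimes> h2 \<otimes> e = (h1 \<otimes> e1) \<otimes> q1" using h car 1(3) by (simp add: m_assoc)
      also have "\<dots> = e2 \<otimes> (q2 \<otimes> q1)" unfolding 2(3) using car by (simp add: m_assoc)
      finally show "h1 \<otimes> h2 \<otimes> e \<in> E <#> square_subgroup"
        by (rule set_multI[OF 2(1) square_subgroup_mult[OF 2(2) 1(2)]])
    qed
  qed
  define S where "S = (\<lambda>(r, e). r \<otimes> e) ` (R \<times> E)"
  have "g \<in> S <#> square_subgroup" if g: "g \<in> carrier G" for g
  proof -
    obtain r k where r: "r \<in> R" "k \<in> H" "g = r \<otimes> k" using g cover by (blast elim: set_multE)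
    have "k \<otimes> \<one> \<in> E <#> square_subgroup" using span[OF subsetD[OF gen r(2)]] E(3) by blast
    then obtain e q where e: "e \<in> E" "q \<in> square_subgroup" "k \<otimes> \<one> = e \<otimes> q"
      by (elim set_multE)
    have "r \<in> carrier G" "k \<in> carrier G" using r(1,2) R(2) by auto
    then have "g = (r \<otimes> e) \<otimes> q"
      using r(3) e(3) E_car[OF e(1)] square_subgroup_carrier[OF e(2)] by (simp add: m_assoc)
    moreover have "r \<otimes> e \<in> S" using r(1) e(1) by (auto simp: S_def)
    ultimately show ?thesis using e(2) by (intro set_multI)
  qed
  then have "carrier G \<subseteq> S <#> square_subgroup" by blast
  moreover have "finite S" using R(1) E(1) by (simp add: S_def)
  moreover have "S \<subseteq> carrier G" using R(2) E_car by (auto simp: S_def)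
  ultimately show ?thesis by (intro exI[of _ S] conjI)
qed

end

section \<open>The Grigorchuk group under composition\<close>

interpretation \<Gamma>: group Grigorchuk_group by (rule group_Grigorchuk_group)

abbreviation (input) \<G> where "\<G> \<equiv> Grigorchuk_group"
abbreviation \<Gamma> where "\<Gamma> \<equiv> carrier \<G>"
abbreviation grig_inv ("inv\<^sub>\<Gamma>") where "inv\<^sub>\<Gamma> \<equiv> m_inv \<G>"
abbreviation "gens \<equiv> {grig_a, grig_b, grig_c, grig_d}"

lemma grig_comp_closed: "f \<in> \<Gamma> \<Longrightarrow> g \<in> \<Gamma> \<Longrightarrow> f \<circ> g \<in> \<Gamma>"
  using \<Gamma>.m_closed[of f g] by (simp add: mult_Grigorchuk_group)

lemma grig_id_closed: "id \<in> \<Gamma>"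
  using \<Gamma>.one_closed by (simp add: one_Grigorchuk_group)

lemma gens_closed: "grig_a \<in> \<Gamma>" "grig_b \<in> \<Gamma>" "grig_c \<in> \<Gamma>" "grig_d \<in> \<Gamma>"
  by (simp_all add: carrier_Grigorchuk_group generate.incl)

lemmas grig_closed = grig_comp_closed grig_id_closed gens_closed

lemma inv_eqI: "f \<in> \<Gamma> \<Longrightarrow> g \<in> \<Gamma> \<Longrightarrow> g \<circ> f = id \<Longrightarrow> inv\<^sub>\<Gamma> f = g"
  by (rule \<Gamma>.inv_equality) (simp_all add: mult_Grigorchuk_group one_Grigorchuk_group)

lemma inv_comp:
  assumes "f \<in> \<Gamma>"
  shows "inv\<^sub>\<Gamma> f \<circ> f = id" "f \<circ> inv\<^sub>\<Gamma> f = id"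
  using \<Gamma>.l_inv[OF assms] \<Gamma>.r_inv[OF assms] assms
  by (simp_all add: mult_Grigorchuk_group one_Grigorchuk_group)

lemma inv_of_comp:
  assumes "f \<in> \<Gamma>" "g \<in> \<Gamma>"
  shows "inv\<^sub>\<Gamma> (f \<circ> g) = inv\<^sub>\<Gamma> g \<circ> inv\<^sub>\<Gamma> f"
  using \<Gamma>.inv_mult_group[OF assms]
  unfolding mult_Grigorchuk_group[OF assms]
    mult_Grigorchuk_group[OF \<Gamma>.inv_closed[OF assms(2)] \<Gamma>.inv_closed[OF assms(1)]] .

lemma gen_involutions:
  "grig_a \<circ> grig_a = id" "grig_b \<circ> grig_b = id" "grig_c \<circ> grig_c = id" "grig_d \<circ> grig_d = id"
  by (simp_all add: fun_eq_iff grig_a_involution grig_bcd_involution)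

lemma klein_four_apply:
  "grig_b (grig_c w) = grig_d w" "grig_c (grig_b w) = grig_d w"
  "grig_c (grig_d w) = grig_b w" "grig_d (grig_c w) = grig_b w"
  "grig_d (grig_b w) = grig_c w" "grig_b (grig_d w) = grig_c w"
proof (induction w)
  case (Cons x w)
  {
    case 1 show ?case by (cases x) (simp_all add: grig_a_involution Cons)
  next
    case 2 show ?case by (cases x) (simp_all add: grig_a_involution Cons)
  next
    case 3 show ?case by (cases x) (simp_all add: grig_a_involution Cons)
  next
    case 4 show ?case by (cases x) (simp_all add: grig_a_involution Cons)
  next
    case 5 show ?case by (cases x) (simp_all add: grig_a_involution Cons)
  next
    case 6 show ?case by (cases x) (simp_all add: grig_a_involution Cons)
  }
qed simp_all

lemma klein_four:
  "grig_b \<circ> grig_c = grig_d" "grig_c \<circ> grig_b = grig_d" "grig_c \<circ> grig_d = grig_b"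
  "grig_d \<circ> grig_c = grig_b" "grig_d \<circ> grig_b = grig_c" "grig_b \<circ> grig_d = grig_c"
  by (simp_all add: fun_eq_iff klein_four_apply)

section \<open>Action on the two subtrees\<close>

fun node :: "(vertex \<Rightarrow> vertex) \<Rightarrow> (vertex \<Rightarrow> vertex) \<Rightarrow> vertex \<Rightarrow> vertex" where
  "node f g [] = []"
| "node f g (False # w) = False # f w"
| "node f g (True # w) = True # g w"

lemma node_comp: "node f g \<circ> node f' g' = node (f \<circ> f') (g \<circ> g')"
proof
  fix w show "(node f g \<circ> node f' g') w = node (f \<circ> f') (g \<circ> g') w"
    by (cases "(f', g', w)" rule: node.cases) auto
qed

lemma node_id: "node id id = id"
proof
  fix w show "node id id w = id w"
    by (cases "(id :: vertex \<Rightarrow> vertex, id :: vertex \<Rightarrow> vertex, w)" rule: node.cases) auto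
qed

lemma swap_node: "grig_a \<circ> node f g = node g f \<circ> grig_a"
proof
  fix w show "(grig_a \<circ> node f g) w = (node g f \<circ> grig_a) w"
    by (cases "(f, g, w)" rule: node.cases) auto
qed

lemma node_inject: "node f g = node f' g' \<longleftrightarrow> f = f' \<and> g = g'"
proof
  assume eq: "node f g = node f' g'"
  have "f w = f' w" "g w = g' w" for w
    using fun_cong[OF eq, of "False # w"] fun_cong[OF eq, of "True # w"] by simp_all
  then show "f = f' \<and> g = g'" by blast
qed simp

lemma node_neq_swap_node: "node f g \<noteq> grig_a \<circ> node f' g'"
proof
  assume "node f g = grig_a \<circ> node f' g'"
  from fun_cong[OF this, of "[False]"] show False by simp
qed

lemma gens_node: "grig_b = node grig_a grig_c" "grig_c = node grig_a grig_d" "grig_d = node id grig_b"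
proof -
  show "grig_b = node grig_a grig_c"
  proof
    fix w show "grig_b w = node grig_a grig_c w" by (cases w rule: grig_b.cases) auto
  qed
  show "grig_c = node grig_a grig_d"
  proof
    fix w show "grig_c w = node grig_a grig_d w" by (cases w rule: grig_b.cases) auto
  qed
  show "grig_d = node id grig_b"
  proof
    fix w show "grig_d w = node id grig_b w" by (cases w rule: grig_b.cases) auto
  qed
qed

section \<open>Words in the generators\<close>

definition word_eval :: "(vertex \<Rightarrow> vertex) list \<Rightarrow> vertex \<Rightarrow> vertex" where
  "word_eval ws = foldr (\<circ>) ws id"

lemma word_eval_simps: "word_eval [] = id" "word_eval (x # ws) = x \<circ> word_eval ws"
  by (simp_all add: word_eval_def)

lemma word_eval_append: "word_eval (us @ vs) = word_eval us \<circ> word_eval vs"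
  by (induction us) (simp_all add: word_eval_simps comp_assoc)

lemma word_eval_closed: "set ws \<subseteq> gens \<Longrightarrow> word_eval ws \<in> \<Gamma>"
  by (induction ws) (auto simp: word_eval_simps grig_closed)

lemma word_eval_rev:
  "set ws \<subseteq> gens \<Longrightarrow> word_eval (rev ws) \<circ> word_eval ws = id"
proof (induction ws)
  case (Cons x ws)
  then have "x \<circ> x = id" using gen_involutions by auto
  then have "word_eval (rev (x # ws)) \<circ> word_eval (x # ws)
      = word_eval (rev ws) \<circ> word_eval ws"
    by (simp add: word_eval_append word_eval_simps fun_eq_iff)
  then show ?case using Cons by simp
qed (simp add: word_eval_simps)

lemma ex_word: "g \<in> \<Gamma> \<Longrightarrow> \<exists>ws. set ws \<subseteq> gens \<and> g = word_eval ws"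
  unfolding Grigorchuk_group_def
proof -
  have car: "carrier (subgroup_generated Aut_tree gens) = \<Gamma>" by (simp add: Grigorchuk_group_def)
  \<comment> \<open>On the group the multiplication of the ambient group is composition; the generation below takes
    place in the ambient group.\<close>
  have mult: "f \<otimes>\<^bsub>Aut_tree\<^esub> g = f \<circ> g" if "f \<in> \<Gamma>" "g \<in> \<Gamma>" for f g
    using mult_Grigorchuk_group[OF that] by (simp add: Grigorchuk_group_def)
  assume "g \<in> carrier (subgroup_generated Aut_tree gens)"
  then have "g \<in> generate Aut_tree gens" unfolding car carrier_Grigorchuk_group .
  then show ?thesis
  proof (induction rule: generate.induct)
    case one
    have "\<one>\<^bsub>Aut_tree\<^esub> = id" using one_Grigorchuk_group by (simp add: Grigorchuk_group_def)
    then show ?case by (intro exI[of _ "[]"]) (simp add: word_eval_simps)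
  next
    case (incl h)
    then show ?case by (intro exI[of _ "[h]"]) (simp add: word_eval_simps)
  next
    case (inv h)
    have h: "h \<in> \<Gamma>" "h \<circ> h = id" using inv gens_closed gen_involutions by auto
    then have "h \<otimes>\<^bsub>Aut_tree\<^esub> h = \<one>\<^bsub>Aut_tree\<^esub>"
      using mult one_Grigorchuk_group by (simp add: Grigorchuk_group_def)
    moreover have "h \<in> carrier Aut_tree" using inv grig_generators_in_Aut_tree by blast
    ultimately have "inv\<^bsub>Aut_tree\<^esub> h = h" using group.inv_equality[OF group_Aut_tree] by blast
    then show ?case using inv by (intro exI[of _ "[h]"]) (simp add: word_eval_simps)
  next
    case (eng h1 h2)
    then obtain us vs where uv: "set us \<subseteq> gens" "h1 = word_eval us" "set vs \<subseteq> gens" "h2 = word_eval vs"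
      by blast
    then have "h1 \<otimes>\<^bsub>Aut_tree\<^esub> h2 = word_eval (us @ vs)"
      by (simp add: mult word_eval_closed word_eval_append)
    then show ?case using uv by (intro exI[of _ "us @ vs"]) simp
  qed
qed

lemma grig_induct [consumes 1, case_names id gen]:
  assumes "g \<in> \<Gamma>" and "P id"
    and step: "\<And>x g. x \<in> gens \<Longrightarrow> g \<in> \<Gamma> \<Longrightarrow> P g \<Longrightarrow> P (x \<circ> g)"
  shows "P g"
proof -
  have "P (word_eval ws)" if "set ws \<subseteq> gens" for ws
    using that by (induction ws) (auto simp: word_eval_simps assms(2) intro!: step word_eval_closed)
  then show ?thesis using ex_word[OF assms(1)] by blast
qed

section \<open>The branch subgroup and its finite index\<close>

definition \<tau> :: "vertex \<Rightarrow> vertex" where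
  "\<tau> = grig_a \<circ> grig_b \<circ> grig_a \<circ> grig_b"

lemma \<tau>_closed: "\<tau> \<in> \<Gamma>"
  by (simp add: \<tau>_def grig_closed)

lemma swap_conj: "grig_a \<circ> node f g \<circ> grig_a = node g f"
  by (simp only: swap_node comp_assoc gen_involutions comp_id)

text \<open>Both entries move the letter below them, so \<open>\<tau>\<close> interchanges 00 with 01 and 10 with 11.\<close>

lemma \<tau>_node: "\<tau> = node (grig_c \<circ> grig_a) (grig_a \<circ> grig_c)"
proof -
  have "\<tau> = (grig_a \<circ> node grig_a grig_c \<circ> grig_a) \<circ> node grig_a grig_c"
    by (simp only: \<tau>_def gens_node(1))
  then show ?thesis by (simp only: swap_conj node_comp)
qed

lemma \<tau>_swap: "grig_a \<circ> \<tau> \<circ> grig_a = node (grig_a \<circ> grig_c) (grig_c \<circ> grig_a)"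
  by (simp only: \<tau>_node swap_conj)

lemma inv_\<tau>: "inv\<^sub>\<Gamma> \<tau> = grig_a \<circ> \<tau> \<circ> grig_a"
proof (rule inv_eqI)
  show "grig_a \<circ> \<tau> \<circ> grig_a \<circ> \<tau> = id"
    by (simp add: \<tau>_def fun_eq_iff grig_a_involution grig_bcd_involution)
qed (intro grig_closed \<tau>_closed)+

text \<open>The normal closure of \<open>\<tau>\<close>, with the generators written as in \<open>square_subgroup_finite_index\<close>.\<close>

definition K :: "(vertex \<Rightarrow> vertex) set" where
  "K = generate \<G>
     {g \<otimes>\<^bsub>\<G>\<^esub> t \<otimes>\<^bsub>\<G>\<^esub> inv\<^sub>\<Gamma> g | g t. g \<in> \<Gamma> \<and> t \<in> {\<tau>}}"

interpretation K: normal K \<G>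
  unfolding K_def
proof (rule \<Gamma>.normal_generateI)
  let ?C = "{g \<otimes>\<^bsub>\<G>\<^esub> t \<otimes>\<^bsub>\<G>\<^esub> inv\<^sub>\<Gamma> g | g t. g \<in> \<Gamma> \<and> t \<in> {\<tau>}}"
  show "?C \<subseteq> \<Gamma>" using \<tau>_closed by auto
  fix h g assume "h \<in> ?C" and g: "g \<in> \<Gamma>"
  then obtain f where f: "f \<in> \<Gamma>" "h = f \<otimes>\<^bsub>\<G>\<^esub> \<tau> \<otimes>\<^bsub>\<G>\<^esub> inv\<^sub>\<Gamma> f" by blast
  have "g \<otimes>\<^bsub>\<G>\<^esub> h \<otimes>\<^bsub>\<G>\<^esub> inv\<^sub>\<Gamma> g =
     (g \<otimes>\<^bsub>\<G>\<^esub> f) \<otimes>\<^bsub>\<G>\<^esub> \<tau> \<otimes>\<^bsub>\<G>\<^esub> inv\<^sub>\<Gamma> (g \<otimes>\<^bsub>\<G>\<^esub> f)"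
    using f g \<tau>_closed by (simp add: \<Gamma>.inv_mult_group \<Gamma>.m_assoc)
  then show "g \<otimes>\<^bsub>\<G>\<^esub> h \<otimes>\<^bsub>\<G>\<^esub> inv\<^sub>\<Gamma> g \<in> ?C"
    using f(1) g by blast
qed

lemma K_closed: "k \<in> K \<Longrightarrow> k \<in> \<Gamma>"
  using K.subset by blast

lemma \<tau>_in_K: "\<tau> \<in> K"
proof -
  have "id \<otimes>\<^bsub>\<G>\<^esub> \<tau> \<otimes>\<^bsub>\<G>\<^esub> inv\<^sub>\<Gamma> id = \<tau>"
    using \<Gamma>.l_one[OF \<tau>_closed] \<Gamma>.r_one[OF \<tau>_closed] \<Gamma>.inv_one by (simp add: one_Grigorchuk_group)
  then show ?thesis unfolding K_def using grig_id_closed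
    by (intro generate.incl) (smt (verit) mem_Collect_eq singletonI)
qed

lemma K_comp: "k \<in> K \<Longrightarrow> l \<in> K \<Longrightarrow> k \<circ> l \<in> K"
  using subgroup.m_closed[OF K.is_subgroup, of k l] by (simp add: K_closed mult_Grigorchuk_group)

lemma K_conj: "g \<in> \<Gamma> \<Longrightarrow> k \<in> K \<Longrightarrow> g \<circ> k \<circ> inv\<^sub>\<Gamma> g \<in> K"
  using K.inv_op_closed2[of g k] by (simp add: K_closed mult_Grigorchuk_group grig_comp_closed)

lemma K_conj': "g \<in> \<Gamma> \<Longrightarrow> k \<in> K \<Longrightarrow> inv\<^sub>\<Gamma> g \<circ> k \<circ> g \<in> K"
  using K_conj[of "inv\<^sub>\<Gamma> g" k] by simp

lemma inv_gens:
  "inv\<^sub>\<Gamma> grig_a = grig_a" "inv\<^sub>\<Gamma> grig_b = grig_b"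
  "inv\<^sub>\<Gamma> grig_c = grig_c" "inv\<^sub>\<Gamma> grig_d = grig_d"
  by (intro inv_eqI gens_closed gen_involutions)+

text \<open>\<open>(ad)\<^sup>4 = 1\<close>: the elements \<open>ada = node b id\<close> and \<open>d = node id b\<close> act on different subtrees and
  so commute.\<close>

lemma dihedral_relation: "grig_d \<circ> grig_a \<circ> grig_d \<circ> grig_a = grig_a \<circ> grig_d \<circ> grig_a \<circ> grig_d"
proof -
  have "grig_a \<circ> grig_d \<circ> grig_a = node grig_b id"
    by (simp only: gens_node(3) swap_conj)
  then have "grig_a \<circ> grig_d \<circ> grig_a \<circ> grig_d = node grig_b grig_b"
    "grig_d \<circ> (grig_a \<circ> grig_d \<circ> grig_a) = node grig_b grig_b"
    by (simp_all only:) (simp_all only: gens_node(3) node_comp id_comp comp_id)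
  then show ?thesis by (simp only: comp_assoc)
qed

text \<open>Modulo \<open>K\<close> the generators \<open>a\<close> and \<open>b\<close> commute, and \<open>b\<close> commutes with \<open>d\<close> anyway. As \<open>c = bd\<close>, the
  quotient is generated by the image of \<open>b\<close>, of order at most 2, and by the image of the dihedral
  group \<open>\<langle>a, d\<rangle>\<close> of order 8.\<close>

lemma K_finite_index: "\<exists>R. finite R \<and> R \<subseteq> \<Gamma> \<and> \<Gamma> \<subseteq> R <#>\<^bsub>\<G>\<^esub> K"
proof -
  define D where "D = word_eval ` {[], [grig_a], [grig_d], [grig_a, grig_d], [grig_d, grig_a],
    [grig_a, grig_d, grig_a], [grig_d, grig_a, grig_d], [grig_a, grig_d, grig_a, grig_d]}"
  define R where "R = D \<union> (\<lambda>y. grig_b \<circ> y) ` D"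
  have D_closed: "y \<in> \<Gamma>" if "y \<in> D" for y
    using that unfolding D_def by (auto intro!: word_eval_closed)
  have "finite R" by (simp add: R_def D_def)
  moreover have R: "R \<subseteq> \<Gamma>" using D_closed by (auto simp: R_def grig_closed)
  have dihedral_apply: "grig_d (grig_a (grig_d (grig_a w))) = grig_a (grig_d (grig_a (grig_d w)))" for w
    using fun_cong[OF dihedral_relation, of w] by simp
  have rel: "grig_a \<circ> (grig_a \<circ> f) = f" "grig_d \<circ> (grig_d \<circ> f) = f"
    "grig_d \<circ> (grig_a \<circ> (grig_d \<circ> (grig_a \<circ> f))) = grig_a \<circ> (grig_d \<circ> (grig_a \<circ> (grig_d \<circ> f)))" for f
    by (simp_all add: fun_eq_iff grig_a_involution grig_bcd_involution dihedral_apply)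
  have aD: "grig_a \<circ> y \<in> D" and dD: "grig_d \<circ> y \<in> D" if "y \<in> D" for y
    using that unfolding D_def by (auto simp: word_eval_simps rel gen_involutions dihedral_relation[unfolded comp_assoc])
  have bR: "grig_b \<circ> r \<in> R" if "r \<in> R" for r
    using that gen_involutions(2) by (auto simp: R_def simp flip: comp_assoc)
  have dR: "grig_d \<circ> r \<in> R" if "r \<in> R" for r
  proof -
    have "grig_d \<circ> (grig_b \<circ> y) = grig_b \<circ> (grig_d \<circ> y)" for y
      by (simp add: fun_eq_iff klein_four_apply)
    then show ?thesis using that dD by (auto simp: R_def)
  qed
  have in_RK: "s \<in> R <#>\<^bsub>\<G>\<^esub> K" if "s \<in> R" for s
    by (rule set_multI[OF that subgroup.one_closed[OF K.is_subgroup]]) (use that R in auto)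
  have aR: "grig_a \<circ> r \<in> R <#>\<^bsub>\<G>\<^esub> K" if r: "r \<in> R" for r
  proof (cases "r \<in> D")
    case True
    then have "grig_a \<circ> r \<in> R" using aD by (simp add: R_def)
    then show ?thesis by (rule in_RK)
  next
    case False
    then obtain y where y: "y \<in> D" "r = grig_b \<circ> y" using r by (auto simp: R_def)
    let ?k = "inv\<^sub>\<Gamma> y \<circ> \<tau> \<circ> y"
    have y\<Gamma>: "y \<in> \<Gamma>" using D_closed y by blast
    have "?k \<in> K" using y\<Gamma> \<tau>_in_K by (rule K_conj')
    moreover have "grig_b \<circ> (grig_a \<circ> y) \<in> R" using aD y by (simp add: R_def)
    moreover have "grig_a \<circ> r = grig_b \<circ> (grig_a \<circ> y) \<circ> ?k"
      using fun_cong[OF inv_comp(2)[OF y\<Gamma>]]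
      by (simp add: y(2) \<tau>_def fun_eq_iff grig_a_involution grig_bcd_involution)
    ultimately show ?thesis
      using R K_closed by (intro set_multI) (auto simp: mult_Grigorchuk_group)
  qed
  have step: "x \<circ> r \<in> R <#>\<^bsub>\<G>\<^esub> K" if x: "x \<in> gens" and r: "r \<in> R" for x r
  proof -
    have "grig_c \<circ> r = grig_b \<circ> (grig_d \<circ> r)" by (simp add: klein_four flip: comp_assoc)
    then show ?thesis using x aR[OF r] in_RK bR dR r by auto
  qed
  have "g \<in> R <#>\<^bsub>\<G>\<^esub> K" if "g \<in> \<Gamma>" for g
    using that
  proof (induction rule: grig_induct)
    case id
    have "id \<in> R" by (auto simp: R_def D_def word_eval_simps)
    then show ?case by (rule in_RK)
  next
    case (gen x g)
    then obtain r k where r: "r \<in> R" "k \<in> K" "g = r \<otimes>\<^bsub>\<G>\<^esub> k" by (elim set_multE)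
    obtain r' k' where r': "r' \<in> R" "k' \<in> K" "x \<circ> r = r' \<otimes>\<^bsub>\<G>\<^esub> k'"
      using step[OF gen(1) r(1)] by (elim set_multE)
    have car: "r \<in> \<Gamma>" "r' \<in> \<Gamma>" "k \<in> \<Gamma>" "k' \<in> \<Gamma>" using r r' R K_closed by auto
    have "x \<circ> g = (x \<circ> r) \<circ> k" using r(3) car by (simp add: mult_Grigorchuk_group comp_assoc)
    also have "\<dots> = r' \<otimes>\<^bsub>\<G>\<^esub> (k' \<circ> k)"
      unfolding r'(3) using car by (simp add: mult_Grigorchuk_group comp_assoc grig_closed)
    finally show ?case using r'(1) K_comp[OF r'(2) r(2)] by (intro set_multI)
  qed
  then show ?thesis using \<open>finite R\<close> R by blast
qed

section \<open>The branch subgroup contains its own square\<close>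

lemma inv_node:
  assumes "f \<in> \<Gamma>" "g \<in> \<Gamma>" "node f g \<in> \<Gamma>"
  shows "inv\<^sub>\<Gamma> (node f g) = node (inv\<^sub>\<Gamma> f) (inv\<^sub>\<Gamma> g)"
proof -
  have "node f g \<circ> node (inv\<^sub>\<Gamma> f) (inv\<^sub>\<Gamma> g) = id"
    using assms by (simp add: node_comp inv_comp node_id)
  then have "inv\<^sub>\<Gamma> (node f g) = inv\<^sub>\<Gamma> (node f g) \<circ> (node f g \<circ> node (inv\<^sub>\<Gamma> f) (inv\<^sub>\<Gamma> g))"
    by simp
  also have "\<dots> = node (inv\<^sub>\<Gamma> f) (inv\<^sub>\<Gamma> g)"
    unfolding comp_assoc[symmetric] inv_comp(1)[OF assms(3)] by simp
  finally show ?thesis .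
qed

text \<open>The generators \<open>aba\<close>, \<open>d\<close>, \<open>b\<close>, \<open>c\<close> act on the right subtree as \<open>a\<close>, \<open>b\<close>, \<open>c\<close>, \<open>d\<close>.\<close>

lemma ex_left_section: "g \<in> \<Gamma> \<Longrightarrow> \<exists>f\<in>\<Gamma>. node f g \<in> \<Gamma>"
proof (induction rule: grig_induct)
  case id
  show ?case using grig_id_closed by (metis node_id)
next
  case (gen x g)
  then obtain f where f: "f \<in> \<Gamma>" "node f g \<in> \<Gamma>" by blast
  have "\<exists>y\<in>\<Gamma>. node y x \<in> \<Gamma>"
    using gen(1) gens_node gens_closed grig_id_closed swap_conj[of grig_a grig_c]
    by (metis grig_comp_closed empty_iff insertE)
  then obtain y where y: "y \<in> \<Gamma>" "node y x \<in> \<Gamma>" by blast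
  then have "node (y \<circ> f) (x \<circ> g) \<in> \<Gamma>" using f grig_comp_closed node_comp by metis
  then show ?case using y(1) f(1) grig_comp_closed by blast
qed

text \<open>The element in question is \<open>\<tau>\<close> times a conjugate of its inverse: on the left subtree the two
  factors cancel, and on the right one they give \<open>acbcab = abab\<close>.\<close>

lemma \<tau>_right_in_K: "node id \<tau> \<in> K"
proof -
  have "\<tau> \<circ> (grig_d \<circ> inv\<^sub>\<Gamma> \<tau> \<circ> inv\<^sub>\<Gamma> grig_d)
    = node (grig_c \<circ> grig_a \<circ> (grig_a \<circ> grig_c)) (grig_a \<circ> grig_c \<circ> (grig_b \<circ> (grig_c \<circ> grig_a) \<circ> grig_b))"
    unfolding inv_\<tau> \<tau>_swap inv_gens by (simp add: \<tau>_node gens_node(3) node_comp)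
  also have "grig_c \<circ> grig_a \<circ> (grig_a \<circ> grig_c) = id"
    by (simp add: fun_eq_iff grig_a_involution grig_bcd_involution)
  also have "grig_a \<circ> grig_c \<circ> (grig_b \<circ> (grig_c \<circ> grig_a) \<circ> grig_b) = \<tau>"
    by (simp add: \<tau>_def fun_eq_iff klein_four_apply grig_bcd_involution)
  finally have "\<tau> \<circ> (grig_d \<circ> inv\<^sub>\<Gamma> \<tau> \<circ> inv\<^sub>\<Gamma> grig_d) = node id \<tau>" .
  moreover have "\<tau> \<circ> (grig_d \<circ> inv\<^sub>\<Gamma> \<tau> \<circ> inv\<^sub>\<Gamma> grig_d) \<in> K"
    by (rule K_comp[OF \<tau>_in_K K_conj[OF gens_closed(4)]]) (simp add: \<tau>_in_K)
  ultimately show ?thesis by simp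
qed

lemma \<tau>_conj_eq: "g \<in> \<Gamma> \<Longrightarrow>
    g \<otimes>\<^bsub>\<G>\<^esub> \<tau> \<otimes>\<^bsub>\<G>\<^esub> inv\<^sub>\<Gamma> g = g \<circ> \<tau> \<circ> inv\<^sub>\<Gamma> g"
  by (simp add: mult_Grigorchuk_group grig_closed \<tau>_closed)

text \<open>Inverses need no case of their own, because \<open>\<tau>\<inverse> = a \<tau> a\<close> is itself a conjugate of \<open>\<tau>\<close>.\<close>

lemma K_induct [consumes 1, case_names id conj comp]:
  assumes "k \<in> K" and "P id" and conj: "\<And>g. g \<in> \<Gamma> \<Longrightarrow> P (g \<circ> \<tau> \<circ> inv\<^sub>\<Gamma> g)"
    and comp: "\<And>k l. k \<in> K \<Longrightarrow> l \<in> K \<Longrightarrow> P k \<Longrightarrow> P l \<Longrightarrow> P (k \<circ> l)"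
  shows "P k"
  using assms(1) unfolding K_def
proof (induction rule: generate.induct)
  case one
  show ?case unfolding one_Grigorchuk_group by (rule assms(2))
next
  case (incl h)
  then obtain g where g: "g \<in> \<Gamma>" "h = g \<circ> \<tau> \<circ> inv\<^sub>\<Gamma> g" by (auto simp: \<tau>_conj_eq)
  show ?case unfolding g(2) by (rule conj[OF g(1)])
next
  case (inv h)
  then obtain g where g: "g \<in> \<Gamma>" "h = g \<circ> \<tau> \<circ> inv\<^sub>\<Gamma> g" by (auto simp: \<tau>_conj_eq)
  have "inv\<^sub>\<Gamma> h = g \<circ> inv\<^sub>\<Gamma> \<tau> \<circ> inv\<^sub>\<Gamma> g"
  proof (rule inv_eqI)
    show "h \<in> \<Gamma>" "g \<circ> inv\<^sub>\<Gamma> \<tau> \<circ> inv\<^sub>\<Gamma> g \<in> \<Gamma>"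
      using g \<tau>_closed by (simp_all add: grig_comp_closed)
    show "g \<circ> inv\<^sub>\<Gamma> \<tau> \<circ> inv\<^sub>\<Gamma> g \<circ> h = id"
      using fun_cong[OF inv_comp(1)[OF g(1)]] fun_cong[OF inv_comp(2)[OF g(1)]]
        fun_cong[OF inv_comp(1)[OF \<tau>_closed]]
      by (simp add: g(2) fun_eq_iff)
  qed
  also have "\<dots> = (g \<circ> grig_a) \<circ> \<tau> \<circ> inv\<^sub>\<Gamma> (g \<circ> grig_a)"
  proof -
    have "inv\<^sub>\<Gamma> (g \<circ> grig_a) = grig_a \<circ> inv\<^sub>\<Gamma> g"
      by (simp only: inv_of_comp[OF g(1) gens_closed(1)] inv_gens)
    then show ?thesis by (simp add: inv_\<tau> comp_assoc)
  qed
  finally have eq: "inv\<^sub>\<Gamma> h = \<dots>" .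
  show ?case unfolding eq by (rule conj[OF grig_comp_closed[OF g(1) gens_closed(1)]])
next
  case (eng h1 h2)
  have "h1 \<in> K" "h2 \<in> K" unfolding K_def by (rule eng.hyps)+
  then have eq: "h1 \<otimes>\<^bsub>\<G>\<^esub> h2 = h1 \<circ> h2"
    by (simp add: mult_Grigorchuk_group K_closed)
  show ?case unfolding eq by (rule comp[OF \<open>h1 \<in> K\<close> \<open>h2 \<in> K\<close> eng.IH])
qed

lemma id_in_K: "id \<in> K"
  using subgroup.one_closed[OF K.is_subgroup] by (simp add: one_Grigorchuk_group)

text \<open>Conjugating \<open>node id \<tau>\<close> by an element acting as \<open>g\<close> on the right subtree gives
  \<open>node id (g \<tau> g\<inverse>)\<close>, whatever it does on the left.\<close>

lemma node_right_in_K: "k \<in> K \<Longrightarrow> node id k \<in> K"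
proof (induction rule: K_induct)
  case id
  show ?case by (simp only: node_id id_in_K)
next
  case (conj g)
  obtain f where f: "f \<in> \<Gamma>" "node f g \<in> \<Gamma>" using ex_left_section[OF conj] by blast
  have eq: "node f g \<circ> node id \<tau> \<circ> inv\<^sub>\<Gamma> (node f g) = node id (g \<circ> \<tau> \<circ> inv\<^sub>\<Gamma> g)"
    using conj f by (simp add: inv_node node_comp inv_comp)
  show ?case using K_conj[OF f(2) \<tau>_right_in_K] unfolding eq .
next
  case (comp k l)
  show ?case using K_comp[OF comp.IH] unfolding node_comp comp_id .
qed

lemma node_in_K:
  assumes "k \<in> K" "l \<in> K"
  shows "node k l \<in> K"
proof -
  have "node k id = grig_a \<circ> node id k \<circ> inv\<^sub>\<Gamma> grig_a" by (simp only: inv_gens swap_conj)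
  also have "\<dots> \<in> K" by (intro K_conj gens_closed node_right_in_K assms)
  finally have "node k id \<circ> node id l \<in> K" by (intro K_comp node_right_in_K assms)
  then show ?thesis by (simp add: node_comp)
qed

section \<open>Halving the number of squares\<close>

abbreviation K_squares ("\<Sigma>") where "\<Sigma> \<equiv> square_products \<G> K"

lemma \<Sigma>_closed: "x \<in> \<Sigma> n \<Longrightarrow> x \<in> K"
  using K.square_products_subset by blast

lemma \<Sigma>_comp: "x \<in> \<Sigma> m \<Longrightarrow> y \<in> \<Sigma> n \<Longrightarrow> x \<circ> y \<in> \<Sigma> (m + n)"
  using K.square_products_mult[of x m y n] \<Sigma>_closed
  by (simp add: mult_Grigorchuk_group K_closed)

lemma \<Sigma>_Suc: "x \<in> \<Sigma> (Suc n) \<longleftrightarrow> (\<exists>k\<in>K. \<exists>y\<in>\<Sigma> n. x = k \<circ> k \<circ> y)"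
proof -
  have "k \<otimes>\<^bsub>\<G>\<^esub> k \<otimes>\<^bsub>\<G>\<^esub> y = k \<circ> k \<circ> y" if "k \<in> K" "y \<in> \<Sigma> n" for k y
    using that \<Sigma>_closed by (simp add: mult_Grigorchuk_group K_closed grig_closed)
  then show ?thesis by (auto, metis)
qed

text \<open>\<open>node (k\<^sup>2) (l\<^sup>2) = (node k l)\<^sup>2\<close>, and \<open>node k l\<close> is again in \<open>K\<close>. This is why squares of elements
  of \<open>K\<close> are counted instead of arbitrary squares.\<close>

lemma node_in_\<Sigma>: "x \<in> \<Sigma> n \<Longrightarrow> y \<in> \<Sigma> n \<Longrightarrow> node x y \<in> \<Sigma> n"
proof (induction n arbitrary: x y)
  case 0
  then have "node x y \<in> \<Sigma> 0" by (simp add: one_Grigorchuk_group node_id)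
  then show ?case .
next
  case (Suc n)
  obtain k x' where x: "k \<in> K" "x' \<in> \<Sigma> n" "x = k \<circ> k \<circ> x'" using Suc.prems \<Sigma>_Suc by blast
  obtain l y' where y: "l \<in> K" "y' \<in> \<Sigma> n" "y = l \<circ> l \<circ> y'" using Suc.prems \<Sigma>_Suc by blast
  have "node x y = node k l \<circ> node k l \<circ> node x' y'" by (simp add: x y node_comp)
  then show ?case
    unfolding \<Sigma>_Suc using node_in_K[OF x(1) y(1)] Suc.IH[OF x(2) y(2)] by blast
qed

lemma \<Sigma>_conj: "g \<in> \<Gamma> \<Longrightarrow> x \<in> \<Sigma> n \<Longrightarrow> g \<circ> x \<circ> inv\<^sub>\<Gamma> g \<in> \<Sigma> n"
  using K.square_products_conj[of g x n] \<Sigma>_closed[of x n]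
  by (simp add: mult_Grigorchuk_group K_closed grig_closed)

text \<open>Conjugation by \<open>\<tau>\<close> moves an entry from 00 to 01 and from 10 to 11; the conjugations by \<open>a\<close> and by
  \<open>d\<close> come from the action of \<open>\<tau>\<close> below these vertices.\<close>

lemma \<tau>_conj_node:
  "inv\<^sub>\<Gamma> \<tau> \<circ> node (node p id) (node r id) \<circ> \<tau>
    = node (node id (grig_a \<circ> p \<circ> grig_a)) (node id (grig_d \<circ> r \<circ> grig_d))"
proof -
  have "inv\<^sub>\<Gamma> \<tau> \<circ> node (node p id) (node r id) \<circ> \<tau>
    = node (grig_a \<circ> (grig_c \<circ> node p id \<circ> grig_c) \<circ> grig_a)
        (grig_c \<circ> (grig_a \<circ> node r id \<circ> grig_a) \<circ> grig_c)"
    unfolding inv_\<tau> \<tau>_swap unfolding \<tau>_node by (simp only: node_comp comp_assoc)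
  also have "grig_c \<circ> node p id \<circ> grig_c = node (grig_a \<circ> p \<circ> grig_a) id"
    by (simp add: gens_node(2) node_comp gen_involutions)
  also have "grig_c \<circ> (grig_a \<circ> node r id \<circ> grig_a) \<circ> grig_c = node id (grig_d \<circ> r \<circ> grig_d)"
    unfolding swap_conj by (simp add: gens_node(2) node_comp gen_involutions)
  finally show ?thesis by (simp only: swap_conj)
qed

text \<open>For \<open>D = node (node p id) (node r id)\<close> the element is \<open>(\<tau>\<inverse> D \<tau>) D = (\<tau>\<inverse>)\<^sup>2 (\<tau> D)\<^sup>2\<close>.\<close>

lemma paired_in_\<Sigma>:
  assumes p: "p \<in> K" and r: "r \<in> K"
  shows "node (node p (grig_a \<circ> p \<circ> grig_a)) (node r (grig_d \<circ> r \<circ> grig_d)) \<in> \<Sigma> 2"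
proof -
  define D where "D = node (node p id) (node r id)"
  have D: "D \<in> K" unfolding D_def by (intro node_in_K p r id_in_K)
  have "node (node p (grig_a \<circ> p \<circ> grig_a)) (node r (grig_d \<circ> r \<circ> grig_d)) = (inv\<^sub>\<Gamma> \<tau> \<circ> D \<circ> \<tau>) \<circ> D"
    unfolding D_def \<tau>_conj_node by (simp add: node_comp)
  also have "\<dots> = inv\<^sub>\<Gamma> \<tau> \<circ> inv\<^sub>\<Gamma> \<tau> \<circ> ((\<tau> \<circ> D) \<circ> (\<tau> \<circ> D) \<circ> id)"
    using fun_cong[OF inv_comp(1)[OF \<tau>_closed]] by (simp add: fun_eq_iff)
  also have "\<dots> \<in> \<Sigma> (Suc (Suc 0))"
  proof -
    have "(\<tau> \<circ> D) \<circ> (\<tau> \<circ> D) \<circ> id \<in> \<Sigma> (Suc 0)"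
      unfolding \<Sigma>_Suc using K_comp[OF \<tau>_in_K D] by (auto simp: one_Grigorchuk_group)
    moreover have "inv\<^sub>\<Gamma> \<tau> \<in> K" using \<tau>_in_K by simp
    ultimately show ?thesis unfolding \<Sigma>_Suc[of _ "Suc 0"] by blast
  qed
  finally show ?thesis by (simp add: numeral_2_eq_2)
qed

text \<open>On each half of the tree the product of \<open>n + n\<close> squares is split as \<open>u v\<close> with \<open>n\<close> squares in each
  factor. A correction of the kind of \<open>paired_in_\<Sigma>\<close> leaves a conjugate of \<open>u\<inverse>\<close> at the first vertex
  and \<open>v\<close> at the second, and the four remaining entries are handled simultaneously.\<close>

lemma merge_in_\<Sigma>:
  assumes h: "h00 \<in> K" "h10 \<in> K"
    and left: "grig_a \<circ> inv\<^sub>\<Gamma> h00 \<circ> grig_a \<circ> h01 \<in> \<Sigma> (n + n)"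
    and right: "grig_d \<circ> inv\<^sub>\<Gamma> h10 \<circ> grig_d \<circ> h11 \<in> \<Sigma> (n + n)"
  shows "node (node h00 h01) (node h10 h11) \<in> \<Sigma> (2 + n)"
proof -
  have split: "\<exists>p\<in>K. \<exists>x\<in>\<Sigma> n. \<exists>y\<in>\<Sigma> n. h = p \<circ> x \<and> h' = s \<circ> p \<circ> s \<circ> y"
    if h: "h \<in> K" and s: "s \<in> \<Gamma>" "s \<circ> s = id" and sum: "s \<circ> inv\<^sub>\<Gamma> h \<circ> s \<circ> h' \<in> \<Sigma> (n + n)"
    for h h' s
  proof -
    obtain u v where uv: "u \<in> \<Sigma> n" "v \<in> \<Sigma> n"
      and eq: "s \<circ> inv\<^sub>\<Gamma> h \<circ> s \<circ> h' = u \<otimes>\<^bsub>\<G>\<^esub> v"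
      using K.square_products_split[OF sum] by blast
    have car: "u \<in> \<Gamma>" "v \<in> \<Gamma>" "h \<in> \<Gamma>" using uv \<Sigma>_closed K_closed h by blast+
    have inv_s: "inv\<^sub>\<Gamma> s = s" using s by (intro inv_eqI)
    have ss: "s (s w) = w" for w using fun_cong[OF s(2)] by simp
    have hh: "h (inv\<^sub>\<Gamma> h w) = w" "inv\<^sub>\<Gamma> h (h w) = w" for w
      using fun_cong[OF inv_comp(1)[OF car(3)]] fun_cong[OF inv_comp(2)[OF car(3)]] by simp_all
    have uu: "u (inv\<^sub>\<Gamma> u w) = w" for w
      using fun_cong[OF inv_comp(2)[OF car(1)]] by simp
    \<comment> \<open>The choice of \<open>p\<close> makes \<open>p\<inverse> h = s u\<inverse> s\<close>, which is what costs only \<open>n\<close> squares.\<close>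
    define p where "p = h \<circ> (s \<circ> u \<circ> s)"
    have pK: "p \<in> K"
      unfolding p_def using K_comp[OF h K_conj[OF s(1) \<Sigma>_closed[OF uv(1)]]] by (simp add: inv_s)
    have x: "s \<circ> inv\<^sub>\<Gamma> u \<circ> s \<in> \<Sigma> n"
      using \<Sigma>_conj[OF s(1) K.square_products_inv[OF uv(1)]] by (simp add: inv_s)
    have "h = p \<circ> (s \<circ> inv\<^sub>\<Gamma> u \<circ> s)"
      by (simp add: p_def fun_eq_iff ss uu)
    moreover have "h' = s \<circ> p \<circ> s \<circ> v"
    proof
      fix w
      have "s (inv\<^sub>\<Gamma> h (s (h' w))) = u (v w)"
        using fun_cong[OF eq, of w] car by (simp add: mult_Grigorchuk_group)
      then have "h' w = s (h (s (u (v w))))" by (metis ss hh(1))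
      then show "h' w = (s \<circ> p \<circ> s \<circ> v) w" by (simp add: p_def ss)
    qed
    ultimately show ?thesis using pK x uv(2) by blast
  qed
  obtain p x0 x1 where p: "p \<in> K" "x0 \<in> \<Sigma> n" "x1 \<in> \<Sigma> n"
    "h00 = p \<circ> x0" "h01 = grig_a \<circ> p \<circ> grig_a \<circ> x1"
    using split[OF h(1) gens_closed(1) gen_involutions(1) left] by blast
  obtain r y0 y1 where r: "r \<in> K" "y0 \<in> \<Sigma> n" "y1 \<in> \<Sigma> n"
    "h10 = r \<circ> y0" "h11 = grig_d \<circ> r \<circ> grig_d \<circ> y1"
    using split[OF h(2) gens_closed(4) gen_involutions(4) right] by blast
  have "node (node h00 h01) (node h10 h11)
    = node (node p (grig_a \<circ> p \<circ> grig_a)) (node r (grig_d \<circ> r \<circ> grig_d))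
      \<circ> node (node x0 x1) (node y0 y1)"
    unfolding p r by (simp only: node_comp)
  also have "\<dots> \<in> \<Sigma> (2 + n)"
    by (intro \<Sigma>_comp paired_in_\<Sigma> node_in_\<Sigma> p r)
  finally show ?thesis .
qed

section \<open>Word length and contraction\<close>

text \<open>The ball of radius \<open>n\<close> in the Cayley graph with respect to the four generators.\<close>

definition grig_ball :: "nat \<Rightarrow> (vertex \<Rightarrow> vertex) set" where
  "grig_ball n = {word_eval ws | ws. set ws \<subseteq> gens \<and> length ws \<le> n}"

lemma grig_ballI: "set ws \<subseteq> gens \<Longrightarrow> length ws \<le> n \<Longrightarrow> word_eval ws \<in> grig_ball n"
  by (auto simp: grig_ball_def)

lemma finite_grig_ball: "finite (grig_ball n)"
proof -
  have "grig_ball n = word_eval ` {ws. set ws \<subseteq> gens \<and> length ws \<le> n}"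
    by (auto simp: grig_ball_def)
  then show ?thesis by (simp add: finite_lists_length_le)
qed

lemma grig_ball_closed: "g \<in> grig_ball n \<Longrightarrow> g \<in> \<Gamma>"
  by (auto simp: grig_ball_def word_eval_closed)

lemma ex_grig_ball: "g \<in> \<Gamma> \<Longrightarrow> \<exists>n. g \<in> grig_ball n"
  using ex_word grig_ballI by blast

lemma grig_ball_mono: "m \<le> n \<Longrightarrow> grig_ball m \<subseteq> grig_ball n"
  by (fastforce simp: grig_ball_def)

lemma gens_in_grig_ball: "x \<in> gens \<Longrightarrow> x \<in> grig_ball 1"
  using grig_ballI[of "[x]" 1] by (simp add: word_eval_simps)

lemma grig_ball_comp:
  assumes "f \<in> grig_ball m" "g \<in> grig_ball n"
  shows "f \<circ> g \<in> grig_ball (m + n)"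
proof -
  obtain us vs where "set us \<subseteq> gens" "length us \<le> m" "f = word_eval us"
    "set vs \<subseteq> gens" "length vs \<le> n" "g = word_eval vs"
    using assms by (auto simp: grig_ball_def)
  then show ?thesis using grig_ballI[of "us @ vs" "m + n"] by (simp add: word_eval_append)
qed

lemma grig_ball_inv:
  assumes "g \<in> grig_ball n"
  shows "inv\<^sub>\<Gamma> g \<in> grig_ball n"
proof -
  obtain ws where ws: "set ws \<subseteq> gens" "length ws \<le> n" "g = word_eval ws"
    using assms by (auto simp: grig_ball_def)
  then have "inv\<^sub>\<Gamma> g = word_eval (rev ws)"
    by (auto intro!: inv_eqI word_eval_closed word_eval_rev)
  then show ?thesis using ws grig_ballI[of "rev ws" n] by simp
qed

lemma a_neq_bcd: "grig_b \<noteq> grig_a" "grig_c \<noteq> grig_a" "grig_d \<noteq> grig_a"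
proof -
  have "grig_a [False] \<noteq> [False]" by simp
  then show "grig_b \<noteq> grig_a" "grig_c \<noteq> grig_a" "grig_d \<noteq> grig_a"
    by (metis grig_bcd_singleton)+
qed

abbreviation bcd_count :: "(vertex \<Rightarrow> vertex) list \<Rightarrow> nat" where
  "bcd_count ws \<equiv> length (filter (\<lambda>x. x \<noteq> grig_a) ws)"

text \<open>The products of two generators other than \<open>a\<close> are trivial or again generators, and \<open>a\<^sup>2 = 1\<close>. A word
  can thus be shortened until \<open>a\<close> occupies every other position.\<close>

lemma alternating_word:
  "set ws \<subseteq> gens \<Longrightarrow> \<exists>vs. set vs \<subseteq> gens \<and> length vs \<le> length ws \<and> word_eval vs = word_eval ws \<and>
     successively (\<lambda>x y. (x = grig_a) \<noteq> (y = grig_a)) vs"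
proof (induction ws)
  case (Cons x ws)
  then obtain vs where vs: "set vs \<subseteq> gens" "length vs \<le> length ws" "word_eval vs = word_eval ws"
    "successively (\<lambda>x y. (x = grig_a) \<noteq> (y = grig_a)) vs" by auto
  have x: "x \<in> gens" using Cons.prems by simp
  show ?case
  proof (cases vs)
    case Nil
    then show ?thesis using vs x by (intro exI[of _ "[x]"]) (simp add: word_eval_simps)
  next
    case (Cons y us)
    show ?thesis
    proof (cases "(x = grig_a) = (y = grig_a)")
      case False
      then show ?thesis using vs x Cons by (intro exI[of _ "x # vs"]) (simp add: word_eval_simps)
    next
      case True
      have us: "successively (\<lambda>x y. (x = grig_a) \<noteq> (y = grig_a)) us" "set us \<subseteq> gens"
        "length us \<le> length ws"
        using vs Cons by (auto simp: successively_Cons)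
      have prod: "word_eval (x # ws) = (x \<circ> y) \<circ> word_eval us"
        using vs(3) Cons by (simp add: word_eval_simps comp_assoc)
      have y: "y \<in> gens" using vs(1) Cons by simp
      show ?thesis
      proof (cases "x = y")
        case True
        then have "x \<circ> y = id" using x gen_involutions by auto
        then show ?thesis using us prod by (intro exI[of _ us]) simp
      next
        case xy: False
        with True x y have "x \<circ> y \<in> gens - {grig_a}"
          using klein_four a_neq_bcd by auto
        moreover have "y \<noteq> grig_a" using True xy by auto
        ultimately show ?thesis
          using us prod vs(2,4) Cons
          by (intro exI[of _ "(x \<circ> y) # us"]) (auto simp: word_eval_simps successively_Cons)
      qed
    qed
  qed
qed simp

lemma alternating_bcd_count:
  "successively (\<lambda>x y. (x = grig_a) \<noteq> (y = grig_a)) ws \<Longrightarrow>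
    2 * bcd_count ws \<le> length ws + (if ws \<noteq> [] \<and> hd ws \<noteq> grig_a then 1 else 0)"
  by (induction ws) (auto simp: successively_Cons split: if_splits)

text \<open>Only the letters \<open>b\<close>, \<open>c\<close>, \<open>d\<close> contribute to the action on the subtrees, one letter at most to each
  subtree, whereas \<open>a\<close> merely interchanges the two.\<close>

lemma word_sections:
  "set ws \<subseteq> gens \<Longrightarrow> \<exists>f\<in>grig_ball (bcd_count ws). \<exists>g\<in>grig_ball (bcd_count ws).
     word_eval ws = node f g \<or> word_eval ws = grig_a \<circ> node f g"
proof (induction ws)
  case Nil
  have "id \<in> grig_ball 0" using grig_ballI[of "[]" 0] by (simp add: word_eval_simps)
  moreover have "word_eval [] = node id id" by (simp only: word_eval_simps node_id)
  moreover have eq: "bcd_count [] = 0" by simp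
  ultimately show ?case unfolding eq by blast
next
  case (Cons x ws)
  have "set ws \<subseteq> gens" using Cons.prems by simp
  from Cons.IH[OF this] obtain f g
    where fg: "f \<in> grig_ball (bcd_count ws)" "g \<in> grig_ball (bcd_count ws)"
      "word_eval ws = node f g \<or> word_eval ws = grig_a \<circ> node f g" by blast
  show ?case
  proof (cases "x = grig_a")
    case True
    have "grig_a \<circ> (grig_a \<circ> node f g) = node f g"
      by (simp only: comp_assoc[symmetric] gen_involutions id_comp)
    then have "word_eval (x # ws) = node f g \<or> word_eval (x # ws) = grig_a \<circ> node f g"
      using fg(3) True word_eval_simps(2) by metis
    moreover have eq: "bcd_count (x # ws) = bcd_count ws" using True by simp
    ultimately show ?thesis unfolding eq using fg(1,2) by blast
  next
    case False
    let ?n = "bcd_count ws"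
    have id1: "id \<in> grig_ball 1" using grig_ballI[of "[]" 1] by (simp add: word_eval_simps)
    have "\<exists>y z. y \<in> grig_ball 1 \<and> z \<in> grig_ball 1 \<and> x = node y z"
      using Cons.prems False gens_node gens_in_grig_ball id1 by auto
    then obtain y z where yz: "y \<in> grig_ball 1" "z \<in> grig_ball 1" "x = node y z" by blast
    have "word_eval (x # ws) = node (y \<circ> f) (z \<circ> g) \<or>
        word_eval (x # ws) = grig_a \<circ> node (z \<circ> f) (y \<circ> g)"
    proof -
      have "node y z \<circ> (grig_a \<circ> node f g) = (grig_a \<circ> node z y) \<circ> node f g"
        by (simp only: swap_node comp_assoc)
      then have "node y z \<circ> (grig_a \<circ> node f g) = grig_a \<circ> node (z \<circ> f) (y \<circ> g)"
        by (simp only: comp_assoc node_comp)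
      then show ?thesis
        unfolding word_eval_simps yz(3) using fg(3) node_comp[of y z f g] by (elim disjE) simp_all
    qed
    moreover have "u \<circ> h \<in> grig_ball (bcd_count (x # ws))"
      if "u \<in> grig_ball 1" "h \<in> grig_ball ?n" for u h
      using grig_ball_comp[OF that] False by simp
    ultimately show ?thesis using fg(1,2) yz(1,2) by blast
  qed
qed

text \<open>Contraction: in an alternating word only half of the letters differ from \<open>a\<close>.\<close>

lemma ball_sections:
  assumes "h \<in> grig_ball n"
  shows "\<exists>f\<in>grig_ball ((n + 1) div 2). \<exists>g\<in>grig_ball ((n + 1) div 2).
     h = node f g \<or> h = grig_a \<circ> node f g"
proof -
  obtain ws where ws: "set ws \<subseteq> gens" "length ws \<le> n" "h = word_eval ws"
    using assms by (auto simp: grig_ball_def)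
  obtain vs where vs: "set vs \<subseteq> gens" "length vs \<le> length ws" "word_eval vs = word_eval ws"
    "successively (\<lambda>x y. (x = grig_a) \<noteq> (y = grig_a)) vs"
    using alternating_word[OF ws(1)] by blast
  have "2 * bcd_count vs \<le> length vs + 1"
    using alternating_bcd_count[OF vs(4)] by (simp split: if_splits)
  then have "bcd_count vs \<le> (n + 1) div 2" using vs(2) ws(2) by linarith
  then have "grig_ball (bcd_count vs) \<subseteq> grig_ball ((n + 1) div 2)" by (rule grig_ball_mono)
  moreover have "h = word_eval vs" using vs(3) ws(3) by simp
  ultimately show ?thesis using word_sections[OF vs(1)] by blast
qed

lemma node_in_ball:
  assumes "node f g \<in> grig_ball n"
  shows "f \<in> grig_ball ((n + 1) div 2)" "g \<in> grig_ball ((n + 1) div 2)"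
  using ball_sections[OF assms] node_neq_swap_node by (auto simp: node_inject)

lemma grig_cases:
  assumes "h \<in> \<Gamma>"
  obtains f g where "f \<in> \<Gamma>" "g \<in> \<Gamma>" "h = node f g \<or> h = grig_a \<circ> node f g"
  using ex_grig_ball[OF assms] ball_sections grig_ball_closed by blast

section \<open>Bounded width for squares from the branch subgroup\<close>

lemma K_is_node:
  assumes "k \<in> K"
  shows "\<exists>f\<in>\<Gamma>. \<exists>g\<in>\<Gamma>. k = node f g"
  using assms
proof (induction rule: K_induct)
  case id
  show ?case using node_id grig_id_closed by metis
next
  case (conj g)
  let ?x = "grig_c \<circ> grig_a" and ?y = "grig_a \<circ> grig_c"
  have xy: "?x \<in> \<Gamma>" "?y \<in> \<Gamma>" by (intro grig_closed)+
  obtain f h where fh: "f \<in> \<Gamma>" "h \<in> \<Gamma>" "g = node f h \<or> g = grig_a \<circ> node f h"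
    using grig_cases[OF conj] by blast
  have n\<Gamma>: "node f h \<in> \<Gamma>"
  proof (cases "g = node f h")
    case False
    then have "node f h = grig_a \<circ> g"
      using fh(3) gen_involutions(1) by (auto simp flip: comp_assoc)
    then show ?thesis using conj by (simp add: grig_closed)
  qed (use conj in simp)
  have eq: "node f h \<circ> \<tau> \<circ> inv\<^sub>\<Gamma> (node f h) = node (f \<circ> ?x \<circ> inv\<^sub>\<Gamma> f) (h \<circ> ?y \<circ> inv\<^sub>\<Gamma> h)"
    using fh n\<Gamma> by (simp only: inv_node \<tau>_node node_comp)
  have car: "f \<circ> ?x \<circ> inv\<^sub>\<Gamma> f \<in> \<Gamma>" "h \<circ> ?y \<circ> inv\<^sub>\<Gamma> h \<in> \<Gamma>"
    using fh xy by (simp_all add: grig_comp_closed)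
  show ?case
  proof (cases "g = node f h")
    case True
    then show ?thesis using eq car by auto
  next
    case False
    then have g: "g = grig_a \<circ> node f h" using fh(3) by blast
    have "inv\<^sub>\<Gamma> g = inv\<^sub>\<Gamma> (node f h) \<circ> grig_a"
      by (simp only: g inv_of_comp[OF gens_closed(1) n\<Gamma>] inv_gens)
    then have "g \<circ> \<tau> \<circ> inv\<^sub>\<Gamma> g = grig_a \<circ> (node f h \<circ> \<tau> \<circ> inv\<^sub>\<Gamma> (node f h)) \<circ> grig_a"
      by (simp add: g comp_assoc)
    then show ?thesis unfolding eq swap_conj using car by blast
  qed
next
  case (comp k l)
  then obtain f g f' g' where "f \<in> \<Gamma>" "g \<in> \<Gamma>" "k = node f g" "f' \<in> \<Gamma>" "g' \<in> \<Gamma>" "l = node f' g'"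
    by blast
  then show ?case using grig_comp_closed node_comp by metis
qed

text \<open>Elements of \<open>K\<close> fix the first level, and the square of any element does so, too. The square of an
  element of \<open>K\<close> thus fixes the first two levels.\<close>

lemma \<Sigma>_second_level:
  "x \<in> \<Sigma> n \<Longrightarrow> \<exists>h00\<in>\<Gamma>. \<exists>h01\<in>\<Gamma>. \<exists>h10\<in>\<Gamma>. \<exists>h11\<in>\<Gamma>. x = node (node h00 h01) (node h10 h11)"
proof (induction n arbitrary: x)
  case 0
  then have "x = node (node id id) (node id id)" by (simp add: one_Grigorchuk_group node_id)
  then show ?case using grig_id_closed by blast
next
  case (Suc n)
  obtain k y where k: "k \<in> K" "y \<in> \<Sigma> n" "x = k \<circ> k \<circ> y" using Suc.prems \<Sigma>_Suc by blast
  have sq: "\<exists>u\<in>\<Gamma>. \<exists>v\<in>\<Gamma>. f \<circ> f = node u v" if f: "f \<in> \<Gamma>" for f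
  proof -
    obtain p q where pq: "p \<in> \<Gamma>" "q \<in> \<Gamma>" "f = node p q \<or> f = grig_a \<circ> node p q"
      using grig_cases[OF f] by blast
    have "(grig_a \<circ> node p q) \<circ> (grig_a \<circ> node p q) = (grig_a \<circ> node p q \<circ> grig_a) \<circ> node p q"
      by (simp only: comp_assoc)
    then have "f \<circ> f = node (p \<circ> p) (q \<circ> q) \<or> f \<circ> f = node (q \<circ> p) (p \<circ> q)"
      using pq(3) by (auto simp only: swap_conj node_comp)
    then show ?thesis using pq(1,2) grig_comp_closed by blast
  qed
  obtain f g where fg: "f \<in> \<Gamma>" "g \<in> \<Gamma>" "k = node f g" using K_is_node[OF k(1)] by blast
  obtain f0 f1 where f: "f0 \<in> \<Gamma>" "f1 \<in> \<Gamma>" "f \<circ> f = node f0 f1" using sq[OF fg(1)] by blast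
  obtain g0 g1 where g: "g0 \<in> \<Gamma>" "g1 \<in> \<Gamma>" "g \<circ> g = node g0 g1" using sq[OF fg(2)] by blast
  obtain y0 y1 y2 y3 where y: "y0 \<in> \<Gamma>" "y1 \<in> \<Gamma>" "y2 \<in> \<Gamma>" "y3 \<in> \<Gamma>"
    "y = node (node y0 y1) (node y2 y3)"
    using Suc.IH[OF k(2)] by blast
  have "x = node (node (f0 \<circ> y0) (f1 \<circ> y1)) (node (g0 \<circ> y2) (g1 \<circ> y3))"
    unfolding k(3) fg(3) y(5) node_comp f(3) g(3) ..
  then show ?case using f(1,2) g(1,2) y(1-4) grig_comp_closed by blast
qed

abbreviation K2 where "K2 \<equiv> K.square_subgroup"

lemma K2_iff: "x \<in> K2 \<longleftrightarrow> (\<exists>n. x \<in> \<Sigma> n)"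
  by (simp add: K.square_subgroup_def)

lemma K2_in_K: "x \<in> K2 \<Longrightarrow> x \<in> K"
  using K2_iff \<Sigma>_closed by blast

lemma K2_closed: "x \<in> K2 \<Longrightarrow> x \<in> \<Gamma>"
  using K2_in_K K_closed by blast

lemma K2_comp: "x \<in> K2 \<Longrightarrow> y \<in> K2 \<Longrightarrow> x \<circ> y \<in> K2"
  unfolding K2_iff using \<Sigma>_comp by blast

lemma K2_conj: "g \<in> \<Gamma> \<Longrightarrow> x \<in> K2 \<Longrightarrow> g \<circ> x \<circ> inv\<^sub>\<Gamma> g \<in> K2"
  unfolding K2_iff using \<Sigma>_conj by blast

lemma K2_inv: "x \<in> K2 \<Longrightarrow> inv\<^sub>\<Gamma> x \<in> K2"
  by (rule K.square_subgroup_inv)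

lemma \<Sigma>_mono: "m \<le> n \<Longrightarrow> x \<in> \<Sigma> m \<Longrightarrow> x \<in> \<Sigma> n"
  using K.square_products_mono by blast

lemma K2_finite_index: "\<exists>S. finite S \<and> S \<subseteq> \<Gamma> \<and> (\<forall>g\<in>\<Gamma>. \<exists>s\<in>S. \<exists>x\<in>K2. g = s \<circ> x)"
proof -
  obtain R where R: "finite R" "R \<subseteq> \<Gamma>" "\<Gamma> \<subseteq> R <#>\<^bsub>\<G>\<^esub> K"
    using K_finite_index by (elim exE conjE)
  have "\<exists>S. finite S \<and> S \<subseteq> \<Gamma> \<and> \<Gamma> \<subseteq> S <#>\<^bsub>\<G>\<^esub> K2"
  proof (rule K.square_subgroup_finite_index[OF R])
    show "finite {\<tau>}" "{\<tau>} \<subseteq> K" using \<tau>_in_K by simp_all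
  qed (simp only: K_def order_refl)
  then obtain S where S: "finite S" "S \<subseteq> \<Gamma>" "\<Gamma> \<subseteq> S <#>\<^bsub>\<G>\<^esub> K2"
    by (elim exE conjE)
  have "\<exists>s\<in>S. \<exists>x\<in>K2. g = s \<circ> x" if "g \<in> \<Gamma>" for g
  proof -
    from subsetD[OF S(3) that] obtain s x
      where sx: "s \<in> S" "x \<in> K2" "g = s \<otimes>\<^bsub>\<G>\<^esub> x"
      by (elim set_multE)
    have "s \<in> \<Gamma>" using sx(1) S(2) by blast
    then have "g = s \<circ> x" using sx(2,3) K2_closed by (simp only: mult_Grigorchuk_group)
    then show ?thesis using sx(1,2) by blast
  qed
  with S(1,2) show ?thesis by (intro exI[of _ S] conjI ballI)
qed

lemma inv_comp_cancel: "t \<in> \<Gamma> \<Longrightarrow> t \<circ> (inv\<^sub>\<Gamma> t \<circ> g) = g"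
  using fun_cong[OF inv_comp(2), of t] by (simp add: fun_eq_iff)

text \<open>Elements of \<open>K2\<close> whose four entries lie in the same cosets of \<open>K2\<close> differ by an element with entries
  in \<open>K2\<close>. As there are finitely many quadruples of cosets, one representative for each quadruple
  that occurs is enough.\<close>

lemma K2_second_level:
  obtains T where "finite T" "T \<subseteq> K2"
    "\<And>g. g \<in> K2 \<Longrightarrow> \<exists>t\<in>T. \<exists>h00\<in>K2. \<exists>h01\<in>K2. \<exists>h10\<in>K2. \<exists>h11\<in>K2.
       inv\<^sub>\<Gamma> t \<circ> g = node (node h00 h01) (node h10 h11)"
proof -
  obtain S where S: "finite S" "S \<subseteq> \<Gamma>" and cover: "\<And>g. g \<in> \<Gamma> \<Longrightarrow> \<exists>s\<in>S. \<exists>x\<in>K2. g = s \<circ> x"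
    using K2_finite_index by (elim exE conjE) blast
  let ?P = "\<lambda>g (s00, s01, s10, s11). \<exists>x00\<in>K2. \<exists>x01\<in>K2. \<exists>x10\<in>K2. \<exists>x11\<in>K2.
    g = node (node (s00 \<circ> x00) (s01 \<circ> x01)) (node (s10 \<circ> x10) (s11 \<circ> x11))"
  have P: "\<exists>s\<in>S \<times> S \<times> S \<times> S. ?P g s" if g: "g \<in> K2" for g
  proof -
    obtain n where "g \<in> \<Sigma> n" using g K2_iff by blast
    then obtain g00 g01 g10 g11 where g: "g00 \<in> \<Gamma>" "g01 \<in> \<Gamma>" "g10 \<in> \<Gamma>" "g11 \<in> \<Gamma>"
      "g = node (node g00 g01) (node g10 g11)"
      using \<Sigma>_second_level by blast
    obtain s00 x00 where 1: "s00 \<in> S" "x00 \<in> K2" "g00 = s00 \<circ> x00" using cover[OF g(1)] by blast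
    obtain s01 x01 where 2: "s01 \<in> S" "x01 \<in> K2" "g01 = s01 \<circ> x01" using cover[OF g(2)] by blast
    obtain s10 x10 where 3: "s10 \<in> S" "x10 \<in> K2" "g10 = s10 \<circ> x10" using cover[OF g(3)] by blast
    obtain s11 x11 where 4: "s11 \<in> S" "x11 \<in> K2" "g11 = s11 \<circ> x11" using cover[OF g(4)] by blast
    have "?P g (s00, s01, s10, s11)"
      unfolding prod.case g(5) 1(3) 2(3) 3(3) 4(3) using 1(2) 2(2) 3(2) 4(2) by blast
    then show ?thesis using 1(1) 2(1) 3(1) 4(1) by blast
  qed
  have fin: "finite (S \<times> S \<times> S \<times> S)" using S(1) by simp
  show thesis
  proof (rule finite_representatives[of "S \<times> S \<times> S \<times> S" K2 ?P, OF fin P])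
    fix T assume T: "finite T" "T \<subseteq> K2"
      and same_coset: "\<And>g. g \<in> K2 \<Longrightarrow> \<exists>t\<in>T. \<exists>s\<in>S \<times> S \<times> S \<times> S. ?P t s \<and> ?P g s"
    show thesis
    proof (rule that[OF T])
      fix g assume g: "g \<in> K2"
      from same_coset[OF g] obtain t s where t: "t \<in> T" and Pt: "?P t s" and Pg: "?P g s"
        by (elim bexE conjE)
      obtain s00 s01 s10 s11 where s: "s = (s00, s01, s10, s11)" by (cases s)
      obtain y00 y01 y10 y11 where y: "y00 \<in> K2" "y01 \<in> K2" "y10 \<in> K2" "y11 \<in> K2"
        "t = node (node (s00 \<circ> y00) (s01 \<circ> y01)) (node (s10 \<circ> y10) (s11 \<circ> y11))"
        using Pt unfolding s prod.case by (elim bexE)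
      obtain x00 x01 x10 x11 where x: "x00 \<in> K2" "x01 \<in> K2" "x10 \<in> K2" "x11 \<in> K2"
        "g = node (node (s00 \<circ> x00) (s01 \<circ> x01)) (node (s10 \<circ> x10) (s11 \<circ> x11))"
        using Pg unfolding s prod.case by (elim bexE)
      define h where "h = node (node (inv\<^sub>\<Gamma> y00 \<circ> x00) (inv\<^sub>\<Gamma> y01 \<circ> x01)) (node (inv\<^sub>\<Gamma> y10 \<circ> x10) (inv\<^sub>\<Gamma> y11 \<circ> x11))"
      have t\<Gamma>: "t \<in> \<Gamma>" using t T(2) K2_closed by blast
      have "t \<circ> h = g"
      proof -
        have cancel: "s \<circ> y \<circ> (inv\<^sub>\<Gamma> y \<circ> x) = s \<circ> x" if "y \<in> K2" for s x y
          by (simp only: comp_assoc inv_comp_cancel[OF K2_closed[OF that], of x])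
        show ?thesis unfolding y(5) x(5) h_def node_comp y(1-4)[THEN cancel] ..
      qed
      then have "inv\<^sub>\<Gamma> t \<circ> g = inv\<^sub>\<Gamma> t \<circ> (t \<circ> h)" by (simp only:)
      also have "\<dots> = h" by (simp only: comp_assoc[symmetric] inv_comp(1)[OF t\<Gamma>] id_comp)
      finally have "inv\<^sub>\<Gamma> t \<circ> g = h" .
      then have "inv\<^sub>\<Gamma> t \<circ> g = node (node (inv\<^sub>\<Gamma> y00 \<circ> x00) (inv\<^sub>\<Gamma> y01 \<circ> x01)) (node (inv\<^sub>\<Gamma> y10 \<circ> x10) (inv\<^sub>\<Gamma> y11 \<circ> x11))"
        by (simp only: h_def)
      then show "\<exists>t\<in>T. \<exists>h00\<in>K2. \<exists>h01\<in>K2. \<exists>h10\<in>K2. \<exists>h11\<in>K2.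
         inv\<^sub>\<Gamma> t \<circ> g = node (node h00 h01) (node h10 h11)"
        using t x(1-4) y(1-4) K2_comp K2_inv by blast
    qed
  qed assumption
qed

text \<open>The constants are chosen in this order: \<open>T\<close> from \<open>K2_second_level\<close>; \<open>c\<close> bounds the number of
  squares in its members and \<open>C\<close> their length; the radius \<open>C + 8\<close> is where the merged elements
  start to be strictly shorter; and \<open>n\<close> must satisfy \<open>c + (2 + n) \<le> 2n\<close> and cover the ball of that
  radius.\<close>

lemma K2_bounded_width: "\<exists>N. K2 \<subseteq> \<Sigma> N"
proof -
  obtain T where T: "finite T" "T \<subseteq> K2"
    and level: "\<And>g. g \<in> K2 \<Longrightarrow> \<exists>t\<in>T. \<exists>h00\<in>K2. \<exists>h01\<in>K2. \<exists>h10\<in>K2. \<exists>h11\<in>K2.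
       inv\<^sub>\<Gamma> t \<circ> g = node (node h00 h01) (node h10 h11)"
    by (rule K2_second_level) blast
  obtain c where c: "T \<subseteq> \<Sigma> c" 
    using finite_subset_chain[of T \<Sigma>] T K2_iff K.square_products_mono by blast
  obtain C where C: "T \<subseteq> grig_ball C" 
    using finite_subset_chain[of T grig_ball] T K2_closed ex_grig_ball grig_ball_mono by blast
  have "finite (K2 \<inter> grig_ball (C + 8))" using finite_grig_ball by simp
  then obtain m0 where m0: "K2 \<inter> grig_ball (C + 8) \<subseteq> \<Sigma> m0" 
    using finite_subset_chain[of "K2 \<inter> grig_ball (C + 8)" \<Sigma>] K2_iff K.square_products_mono by blast
  define n where "n = max m0 (c + 2)"
  have "g \<in> \<Sigma> (n + n)" if "g \<in> K2" "g \<in> grig_ball l" for g l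
    using that
  proof (induction l arbitrary: g rule: less_induct)
    case (less l)
    show ?case
    proof (cases "l \<le> C + 8")
      case True
      then have "g \<in> \<Sigma> m0" using m0 less.prems grig_ball_mono by blast
      then show ?thesis by (rule \<Sigma>_mono[rotated]) (simp add: n_def)
    next
      case False
      obtain t h00 h01 h10 h11 where t: "t \<in> T"
        and h: "h00 \<in> K2" "h01 \<in> K2" "h10 \<in> K2" "h11 \<in> K2"
        and eq: "inv\<^sub>\<Gamma> t \<circ> g = node (node h00 h01) (node h10 h11)"
        using level[OF less.prems(1)] by (elim bexE)
      define M where "M = ((C + l + 1) div 2 + 1) div 2"
      have "inv\<^sub>\<Gamma> t \<circ> g \<in> grig_ball (C + l)"
        using t C less.prems(2) by (intro grig_ball_comp grig_ball_inv) auto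
      then have M: "h00 \<in> grig_ball M" "h01 \<in> grig_ball M" "h10 \<in> grig_ball M" "h11 \<in> grig_ball M"
        unfolding eq M_def by (blast dest: node_in_ball)+
      have "1 + M + 1 + M < l" using False by (simp add: M_def)
      have merged: "s \<circ> inv\<^sub>\<Gamma> h \<circ> s \<circ> h' \<in> \<Sigma> (n + n)"
        if "s \<in> gens" "h \<in> K2" "h' \<in> K2" "h \<in> grig_ball M" "h' \<in> grig_ball M" for s h h'
      proof (rule less.IH[OF \<open>1 + M + 1 + M < l\<close>])
        have "s \<in> \<Gamma>" "inv\<^sub>\<Gamma> s = s" using that(1) gens_closed inv_gens by auto
        then show "s \<circ> inv\<^sub>\<Gamma> h \<circ> s \<circ> h' \<in> K2"
          using K2_comp[OF K2_conj[OF _ K2_inv[OF that(2)]] that(3), of s] by simp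
        show "s \<circ> inv\<^sub>\<Gamma> h \<circ> s \<circ> h' \<in> grig_ball (1 + M + 1 + M)"
          by (intro grig_ball_comp gens_in_grig_ball grig_ball_inv that)
      qed
      have "node (node h00 h01) (node h10 h11) \<in> \<Sigma> (2 + n)"
        using h M by (intro merge_in_\<Sigma> merged) (simp_all add: K2_in_K)
      moreover have "t \<in> \<Sigma> c" using t c by blast
      ultimately have "t \<circ> (inv\<^sub>\<Gamma> t \<circ> g) \<in> \<Sigma> (c + (2 + n))" unfolding eq by (intro \<Sigma>_comp)
      then have "g \<in> \<Sigma> (c + (2 + n))"
        using t T(2) K2_closed by (simp add: inv_comp_cancel subset_iff)
      then show ?thesis by (rule \<Sigma>_mono[rotated]) (simp add: n_def)
    qed
  qed
  then show ?thesis using ex_grig_ball K2_closed by blast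
qed

section \<open>Width of the verbal subgroup\<close>

definition square_words :: "('a, 'b) monoid_scheme \<Rightarrow> nat \<Rightarrow> 'a set" where
  "square_words G n = {list_product G xs | xs. length xs \<le> n \<and> set xs \<subseteq> squares G}"

lemma square_words_mono: "m \<le> n \<Longrightarrow> square_words G m \<subseteq> square_words G n"
  unfolding square_words_def using order_trans by blast

context group
begin

lemma squares_carrier: "squares G \<subseteq> carrier G"
  by (auto simp: squares_def)

lemma list_product_carrier: "set xs \<subseteq> carrier G \<Longrightarrow> list_product G xs \<in> carrier G"
  by (induction xs) (auto simp: list_product_def)

lemma list_product_append:
  "set xs \<subseteq> carrier G \<Longrightarrow> set ys \<subseteq> carrier G \<Longrightarrow>
    list_product G (xs @ ys) = list_product G xs \<otimes> list_product G ys"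
proof (induction xs)
  case Nil
  then show ?case using list_product_carrier[of ys] by (simp add: list_product_def)
next
  case (Cons x xs)
  then show ?case
    using list_product_carrier[of xs] list_product_carrier[of ys]
    by (simp add: list_product_def m_assoc)
qed

lemma square_words_mult:
  assumes "x \<in> square_words G m" "y \<in> square_words G n"
  shows "x \<otimes> y \<in> square_words G (m + n)"
proof -
  obtain xs where xs: "x = list_product G xs" "length xs \<le> m" "set xs \<subseteq> squares G"
    using assms(1) by (auto simp: square_words_def)
  obtain ys where ys: "y = list_product G ys" "length ys \<le> n" "set ys \<subseteq> squares G"
    using assms(2) by (auto simp: square_words_def)
  have "x \<otimes> y = list_product G (xs @ ys)"
    unfolding xs(1) ys(1) using xs(3) ys(3) squares_carrier
    by (intro list_product_append[symmetric]) auto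
  moreover have "length (xs @ ys) \<le> m + n" "set (xs @ ys) \<subseteq> squares G"
    using xs ys by auto
  ultimately show ?thesis unfolding square_words_def by blast
qed

lemma one_in_square_words: "\<one> \<in> square_words G 0"
  by (simp add: square_words_def list_product_def)

lemma square_in_square_words: "x \<in> squares G \<Longrightarrow> x \<in> square_words G 1"
  unfolding square_words_def using squares_carrier
  by (intro CollectI exI[of _ "[x]"]) (auto simp: list_product_def)

lemma inv_square: "x \<in> squares G \<Longrightarrow> inv x \<in> squares G"
  by (auto simp: squares_def simp flip: nat_pow_inv)

lemma generate_squares_word: "x \<in> generate G (squares G) \<Longrightarrow> \<exists>n. x \<in> square_words G n"
proof (induction rule: generate.induct)
  case one
  then show ?case using one_in_square_words by blast
next
  case (incl h)
  then show ?case using square_in_square_words by blast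
next
  case (inv h)
  then show ?case using square_in_square_words inv_square by blast
next
  case (eng h1 h2)
  then show ?case using square_words_mult by blast
qed

end

lemma (in normal) square_products_word: "x \<in> SP n \<Longrightarrow> x \<in> square_words G n"
proof (induction n arbitrary: x)
  case 0
  then show ?case using one_in_square_words by simp
next
  case (Suc n)
  then obtain k y where k: "k \<in> H" "y \<in> SP n" "x = k \<otimes> k \<otimes> y" by auto
  have "k \<in> carrier G" using k(1) by simp
  moreover from this have "k \<otimes> k = k [^] (2::nat)" by (simp add: numeral_2_eq_2)
  ultimately have "k \<otimes> k \<in> squares G" unfolding squares_def by blast
  from square_words_mult[OF square_in_square_words[OF this] Suc.IH[OF k(2)]]
  show ?case by (simp add: k(3))
qed

theorem mainTheorem3:
  shows "\<exists>N::nat. \<forall>g \<in> generate Grigorchuk_group (squares Grigorchuk_group).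
           \<exists>xs. length xs \<le> N \<and> set xs \<subseteq> squares Grigorchuk_group \<and>
                g = list_product Grigorchuk_group xs"
proof -
  let ?V = "generate \<G> (squares \<G>)"
  have V_closed: "g \<in> \<Gamma>" if "g \<in> ?V" for g
    using that \<Gamma>.generate_incl[OF \<Gamma>.squares_carrier] by blast
  obtain S where S: "finite S" "S \<subseteq> \<Gamma>" and cover: "\<forall>g\<in>\<Gamma>. \<exists>s\<in>S. \<exists>x\<in>K2. g = s \<circ> x"
    using K2_finite_index by (elim exE conjE)
  let ?P = "\<lambda>g s. \<exists>x\<in>K2. g = s \<circ> x"
  have P: "\<exists>s\<in>S. ?P g s" if "g \<in> ?V" for g using cover V_closed[OF that] by (rule bspec)
  obtain N0 where N0: "K2 \<subseteq> \<Sigma> N0" using K2_bounded_width by (rule exE)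
  have goal: "\<exists>N. ?V \<subseteq> square_words \<G> N"
  proof (rule finite_representatives[of S ?V ?P, OF S(1) P])
    fix T assume T: "finite T" "T \<subseteq> ?V"
      and same_coset: "\<And>g. g \<in> ?V \<Longrightarrow> \<exists>t\<in>T. \<exists>s\<in>S. ?P t s \<and> ?P g s"
    have "\<exists>M. T \<subseteq> square_words \<G> M"
      using T(1) \<Gamma>.generate_squares_word[OF subsetD[OF T(2)]] square_words_mono
      by (rule finite_subset_chain)
    then obtain M where M: "T \<subseteq> square_words \<G> M" by (rule exE)
    have "g \<in> square_words \<G> (M + N0)" if g: "g \<in> ?V" for g
    proof -
      from same_coset[OF g] obtain t s x y where t: "t \<in> T" and s: "s \<in> S"
        and y: "y \<in> K2" "t = s \<circ> y" and x: "x \<in> K2" "g = s \<circ> x"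
        by (elim bexE conjE)
      have "inv\<^sub>\<Gamma> y \<circ> x \<in> K2" using x(1) y(1) by (intro K2_comp K2_inv)
      then have "inv\<^sub>\<Gamma> y \<circ> x \<in> square_words \<G> N0"
        using N0 K.square_products_word by blast
      moreover have "g = t \<otimes>\<^bsub>\<G>\<^esub> (inv\<^sub>\<Gamma> y \<circ> x)"
      proof -
        have "y \<circ> (inv\<^sub>\<Gamma> y \<circ> x) = x" by (rule inv_comp_cancel[OF K2_closed[OF y(1)]])
        then have "g = t \<circ> (inv\<^sub>\<Gamma> y \<circ> x)" by (simp only: x(2) y(2) comp_assoc)
        then show ?thesis
          using t T(2) V_closed \<open>inv\<^sub>\<Gamma> y \<circ> x \<in> K2\<close> K2_closed
          by (simp only: mult_Grigorchuk_group subset_iff)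
      qed
      moreover have "t \<in> square_words \<G> M" using t M by blast
      ultimately show ?thesis using \<Gamma>.square_words_mult by simp
    qed
    then show "\<exists>N. ?V \<subseteq> square_words \<G> N" by blast
  qed assumption
  then show ?thesis unfolding square_words_def by blast
qed

end
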